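(* For $a,b,c,d\in\mathbb{Q}$ let $f_{a,b,c,d}:\mathbb{P}^2_{\mathbb{Q}}\to\mathbb{P}^2_{\mathbb{Q}}$ be the morphism extending the affine map $f_{a,b,c,d}(x,y)=(x^2+ax+by,\ y^2+cx+dy)$, i.e. $[x:y:z]\mapsto[x^2+axz+byz:y^2+cxz+dyz:z^2]$. Then $f_{a,b,c,d}$ is post-critically finite if and only if \[(a,b,c,d)\in\{(0,0,0,0),(0,0,0,-2),(-2,0,0,-2),(0,0,-1,0),(0,0,-2,0),(0,-2,-2,0)\}\] or $f_{a,b,c,d}$ is conjugate to one of the maps $f_{a',b',c',d'}$ with $(a',b',c',d')$ in this list by a change of coordinates.
   Context: A morphism $f:\mathbb{P}^2\to\mathbb{P}^2$ is post-critically finite if the forward orbit under $f$ of its critical (ramification) locus is supported on a finite union of curves. *)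

theory Defs
  imports "HOL-Analysis.Analysis"
begin

text \<open>Points of the projective plane over the complex numbers (an algebraically
closed field containing the rationals) are represented by nonzero vectors in
complex^3 (homogeneous coordinates, index 1 = x, 2 = y, 3 = z).
A morphism of the projective plane is represented by its homogeneous lift.\<close>

definition fmap :: "complex \<Rightarrow> complex \<Rightarrow> complex \<Rightarrow> complex \<Rightarrow> complex^3 \<Rightarrow> complex^3" where
  "fmap a b c d p = (\<chi> i. if i = 1 then (p$1)^2 + a * p$1 * p$3 + b * p$2 * p$3
                         else if i = 2 then (p$2)^2 + c * p$1 * p$3 + d * p$2 * p$3
                         else (p$3)^2)"

definition crit_locus :: "(complex^3 \<Rightarrow> complex^3) \<Rightarrow> (complex^3) set" where
  "crit_locus F = {p. p \<noteq> 0 \<and> (\<forall>D. (F has_derivative D) (at p) \<longrightarrow> \<not> inj D)}"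

definition hom_eval :: "nat \<Rightarrow> (nat \<Rightarrow> nat \<Rightarrow> complex) \<Rightarrow> complex^3 \<Rightarrow> complex" where
  "hom_eval m cf p = (\<Sum>i\<le>m. \<Sum>j\<le>m - i. cf i j * (p$1)^i * (p$2)^j * (p$3)^(m - i - j))"

definition nonzero_hom :: "nat \<Rightarrow> (nat \<Rightarrow> nat \<Rightarrow> complex) \<Rightarrow> bool" where
  "nonzero_hom m cf \<longleftrightarrow> (\<exists>i j. i + j \<le> m \<and> cf i j \<noteq> 0)"

text \<open>Post-critically finite: the forward orbit of the critical locus is contained
in a finite union of curves, i.e. in the zero set of a single nonzero
homogeneous polynomial (the product of the equations of the curves).\<close>

definition pcf :: "(complex^3 \<Rightarrow> complex^3) \<Rightarrow> bool" where
  "pcf F \<longleftrightarrow> (\<exists>m cf. nonzero_hom m cf \<and>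
      (\<forall>n. \<forall>p\<in>crit_locus F. hom_eval m cf ((F ^^ n) p) = 0))"

definition proj_conj :: "(complex^3 \<Rightarrow> complex^3) \<Rightarrow> (complex^3 \<Rightarrow> complex^3) \<Rightarrow> bool" where
  "proj_conj F G \<longleftrightarrow> (\<exists>M :: complex^3^3. invertible M \<and>
      (\<forall>p. p \<noteq> 0 \<longrightarrow> (\<exists>l. l \<noteq> 0 \<and> F (M *v p) = l *s (M *v G p))))"

definition pcf_list :: "(rat \<times> rat \<times> rat \<times> rat) set" where
  "pcf_list = {(0,0,0,0), (0,0,0,-2), (-2,0,0,-2), (0,0,-1,0), (0,0,-2,0), (0,-2,-2,0)}"

definition fq :: "rat \<Rightarrow> rat \<Rightarrow> rat \<Rightarrow> rat \<Rightarrow> complex^3 \<Rightarrow> complex^3" where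
  "fq a b c d = fmap (of_rat a) (of_rat b) (of_rat c) (of_rat d)"

end

theory Submission
  imports Defs
begin

text \<open>In the coordinates \<open>X = x + a/2\<close>, \<open>Y = y + d/2\<close> the map is
  \<open>(X, Y) \<mapsto> (X\<^sup>2 + b Y + \<alpha>, Y\<^sup>2 + c X + \<beta>)\<close> with critical curve \<open>4 X Y = b c\<close>. Follow the
  branch of this curve at the fixed point \<open>[1 : 0 : 0]\<close>, parametrised by \<open>t \<rightarrow> \<infinity>\<close>. The \<open>n\<close>-th image
  satisfies \<open>Y\<^sub>n \<sim> c\<^sub>n X\<^sub>n\<^bsup>1/2\<^esup>\<close>, where \<open>c\<^sub>n\<close> is the orbit of \<open>0\<close> under \<open>z\<^sup>2 + c\<close>. By the Newton polygon,
  an algebraic curve has only finitely many growth exponents and leading coefficients at infinity,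
  so post-critical finiteness makes this orbit finite, that is \<open>c \<in> {0, -1, -2}\<close> over the rationals.
  When \<open>c = -1\<close> or \<open>c = -2\<close>, the leading term cancels in \<open>Y\<^sub>2\<^sub>n\<close>, respectively in \<open>Y\<^sub>n\<^sup>2 - 4 X\<^sub>n + \<beta>\<close>,
  and unless \<open>\<alpha> = \<beta> = 0\<close> and \<open>b = 0\<close> (or \<open>b = -2\<close> in the second case) the relative growth exponents
  strictly increase forever. By symmetry the same holds for \<open>b\<close>, and \<open>b = c = 0\<close> is a product of
  quadratic polynomials. Finally \<open>(b, c, \<alpha>, \<beta>)\<close> determines the map up to translation.\<close>

section \<open>Homogeneous polynomials and invariance under conjugation\<close>

text \<open>Leaving the coefficients existential lets equations of curves be assembled by closure
  rules, without computing coefficient arrays.\<close>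

definition hom_poly :: "nat \<Rightarrow> (complex^3 \<Rightarrow> complex) \<Rightarrow> bool" where
  "hom_poly m h \<longleftrightarrow> (\<exists>cf. h = hom_eval m cf)"

lemma hom_poly_0: "hom_poly m (\<lambda>p. 0)"
  unfolding hom_poly_def hom_eval_def by (rule exI[of _ "\<lambda>i j. 0"]) simp

lemma hom_poly_const: "hom_poly 0 (\<lambda>p. c)"
  unfolding hom_poly_def hom_eval_def by (rule exI[of _ "\<lambda>i j. c"]) simp

lemma hom_poly_add:
  assumes "hom_poly m g" "hom_poly m h"
  shows "hom_poly m (\<lambda>p. g p + h p)"
proof -
  obtain cf cf' where "g = hom_eval m cf" "h = hom_eval m cf'"
    using assms by (auto simp: hom_poly_def)
  then have "(\<lambda>p. g p + h p) = hom_eval m (\<lambda>i j. cf i j + cf' i j)"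
    by (simp add: fun_eq_iff hom_eval_def sum.distrib distrib_right)
  then show ?thesis by (auto simp: hom_poly_def)
qed

lemma hom_poly_scale:
  assumes "hom_poly m h"
  shows "hom_poly m (\<lambda>p. c * h p)"
proof -
  obtain cf where "h = hom_eval m cf"
    using assms by (auto simp: hom_poly_def)
  then have "(\<lambda>p. c * h p) = hom_eval m (\<lambda>i j. c * cf i j)"
    by (simp add: fun_eq_iff hom_eval_def sum_distrib_left mult.assoc)
  then show ?thesis by (auto simp: hom_poly_def)
qed

lemma hom_poly_sum:
  assumes "\<And>i. i \<in> A \<Longrightarrow> hom_poly m (h i)"
  shows "hom_poly m (\<lambda>p. \<Sum>i\<in>A. h i p)"
  using assms
  by (induction A rule: infinite_finite_induct) (auto intro: hom_poly_0 hom_poly_add)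

lemma hom_poly_coord_mult:
  assumes "hom_poly m h"
  shows "hom_poly (Suc m) (\<lambda>p. p$k * h p)"
proof -
  obtain cf where h: "h = hom_eval m cf"
    using assms by (auto simp: hom_poly_def)
  consider "k = 1" | "k = 2" | "k = 3" using exhaust_3 by blast
  then show ?thesis
  proof cases
    case 1
    have "(\<lambda>p. p$k * h p) = hom_eval (Suc m) (\<lambda>i j. if i = 0 then 0 else cf (i - 1) j)"
      unfolding h hom_eval_def fun_eq_iff 1 sum.atMost_Suc_shift
      by (simp add: sum_distrib_left mult_ac)
    then show ?thesis by (auto simp: hom_poly_def)
  next
    case 2
    have "p$2 * hom_eval m cf p =
        hom_eval (Suc m) (\<lambda>i j. if j = 0 then 0 else cf i (j - 1)) p" for p
    proof -
      have "hom_eval (Suc m) (\<lambda>i j. if j = 0 then 0 else cf i (j - 1)) p =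
        (\<Sum>i\<le>m. \<Sum>j\<le>Suc m - i. (if j = 0 then 0 else cf i (j - 1)) *
           p$1 ^ i * p$2 ^ j * p$3 ^ (Suc m - i - j))"
        by (simp add: hom_eval_def)
      also have "\<dots> = (\<Sum>i\<le>m. \<Sum>j\<le>m - i. p$2 * (cf i j *
           p$1 ^ i * p$2 ^ j * p$3 ^ (m - i - j)))"
        by (rule sum.cong[OF refl])
           (simp add: Suc_diff_le sum.atMost_Suc_shift mult_ac del: sum.atMost_Suc)
      finally show ?thesis by (simp add: hom_eval_def sum_distrib_left)
    qed
    then have "(\<lambda>p. p$k * h p) = hom_eval (Suc m) (\<lambda>i j. if j = 0 then 0 else cf i (j - 1))"
      by (simp add: h 2 fun_eq_iff)
    then show ?thesis by (auto simp: hom_poly_def)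
  next
    case 3
    \<comment> \<open>Here \<open>i\<close> and \<open>j\<close> stay unchanged, but degree
      \<open>Suc m\<close> admits the new pairs \<open>i + j = Suc m\<close>, where
      \<open>cf\<close> is arbitrary and has to be replaced by 0.\<close>
    have "p$3 * hom_eval m cf p =
        hom_eval (Suc m) (\<lambda>i j. if i + j \<le> m then cf i j else 0) p" for p
    proof -
      have "hom_eval (Suc m) (\<lambda>i j. if i + j \<le> m then cf i j else 0) p =
        (\<Sum>i\<le>m. \<Sum>j\<le>Suc m - i. (if i + j \<le> m then cf i j else 0) *
           p$1 ^ i * p$2 ^ j * p$3 ^ (Suc m - i - j))"
        by (simp add: hom_eval_def)
      also have "\<dots> = (\<Sum>i\<le>m. \<Sum>j\<le>m - i. p$3 * (cf i j *
           p$1 ^ i * p$2 ^ j * p$3 ^ (m - i - j)))"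
        by (rule sum.cong[OF refl])
           (auto simp add: Suc_diff_le mult_ac intro!: sum.cong)
      finally show ?thesis by (simp add: hom_eval_def sum_distrib_left)
    qed
    then have "(\<lambda>p. p$k * h p) = hom_eval (Suc m) (\<lambda>i j. if i + j \<le> m then cf i j else 0)"
      by (simp add: h 3 fun_eq_iff)
    then show ?thesis by (auto simp: hom_poly_def)
  qed
qed

lemma hom_poly_coord_power_mult:
  "hom_poly m h \<Longrightarrow> hom_poly (n + m) (\<lambda>p. (p$k) ^ n * h p)"
proof (induction n)
  case (Suc n)
  from hom_poly_coord_mult[OF Suc.IH[OF Suc.prems], of k] show ?case
    by (simp add: mult.assoc)
qed simp

lemma hom_poly_mult:
  assumes "hom_poly m g" "hom_poly n h"
  shows "hom_poly (m + n) (\<lambda>p. g p * h p)"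
proof -
  obtain cf where g: "g = hom_eval m cf"
    using assms by (auto simp: hom_poly_def)
  have "hom_poly (m + n) (\<lambda>p. cf i j * ((p$1)^i * ((p$2)^j * ((p$3)^(m - i - j) * h p))))"
    if "i \<le> m" "j \<le> m - i" for i j
  proof -
    have "i + (j + ((m - i - j) + n)) = m + n" using that by simp
    then show ?thesis
      using hom_poly_scale[OF hom_poly_coord_power_mult[OF hom_poly_coord_power_mult[OF
        hom_poly_coord_power_mult[OF assms(2)]]], of i j "m - i - j" "cf i j" 1 2 3]
      by simp
  qed
  then have "hom_poly (m + n) (\<lambda>p. \<Sum>i\<le>m. \<Sum>j\<le>m - i.
      cf i j * ((p$1)^i * ((p$2)^j * ((p$3)^(m - i - j) * h p))))"
    by (intro hom_poly_sum) auto
  then show ?thesis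
    by (simp add: g hom_eval_def sum_distrib_right mult.assoc)
qed

lemma hom_poly_coord: "hom_poly 1 (\<lambda>p. p$k)"
  using hom_poly_coord_mult[OF hom_poly_const[of 1], of k] by simp

lemma hom_poly_diff:
  assumes "hom_poly m g" "hom_poly m h"
  shows "hom_poly m (\<lambda>p. g p - h p)"
  using hom_poly_add[OF assms(1) hom_poly_scale[OF assms(2), of "-1"]] by simp

lemma hom_poly_power:
  assumes "hom_poly m h"
  shows "hom_poly (n * m) (\<lambda>p. h p ^ n)"
  by (induction n) (use hom_poly_const[of 1] hom_poly_mult[OF assms] in auto)

lemma hom_poly_linear_subst:
  assumes "hom_poly m h"
  shows "hom_poly m (\<lambda>p. h (M *v p))"
proof -
  obtain cf where h: "h = hom_eval m cf"
    using assms by (auto simp: hom_poly_def)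
  have lin: "hom_poly n (\<lambda>p. ((M *v p)$k)^n)" for k n
  proof -
    have "hom_poly 1 (\<lambda>p. \<Sum>l\<in>UNIV. M$k$l * p$l)"
      by (intro hom_poly_sum hom_poly_scale hom_poly_coord)
    from hom_poly_power[OF this, of n] show ?thesis
      by (simp add: matrix_vector_mult_def)
  qed
  have "hom_poly m (\<lambda>p. cf i j * ((M *v p)$1^i * ((M *v p)$2^j * (M *v p)$3^(m - i - j))))"
    if "i \<le> m" "j \<le> m - i" for i j
  proof -
    have "i + (j + (m - i - j)) = m" using that by simp
    moreover have "hom_poly (i + (j + (m - i - j)))
        (\<lambda>p. cf i j * ((M *v p)$1^i * ((M *v p)$2^j * (M *v p)$3^(m - i - j))))"
      by (intro hom_poly_scale hom_poly_mult lin)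
    ultimately show ?thesis by simp
  qed
  then have "hom_poly m (\<lambda>p. \<Sum>i\<le>m. \<Sum>j\<le>m - i. cf i j *
      ((M *v p)$1^i * ((M *v p)$2^j * (M *v p)$3^(m - i - j))))"
    by (intro hom_poly_sum) auto
  then show ?thesis by (simp add: h hom_eval_def mult.assoc)
qed

lemma hom_poly_scaleC:
  assumes "hom_poly m h"
  shows "h (l *s p) = l ^ m * h p"
proof -
  obtain cf where h: "h = hom_eval m cf"
    using assms by (auto simp: hom_poly_def)
  have "cf i j * (l * p$1)^i * (l * p$2)^j * (l * p$3)^(m - i - j) =
     l ^ m * (cf i j * (p$1)^i * (p$2)^j * (p$3)^(m - i - j))" if "i \<le> m" "j \<le> m - i" for i j
  proof -
    have "l ^ m = l ^ i * l ^ j * l ^ (m - i - j)"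
      using that by (simp flip: power_add)
    then show ?thesis by (simp add: power_mult_distrib)
  qed
  then show ?thesis
    unfolding h hom_eval_def sum_distrib_left
    by (intro sum.cong refl) (simp add: vector_smult_component)
qed

text \<open>A form that does not vanish at one point has a nonzero coefficient, so nontriviality is
  certified by evaluation.\<close>

lemma pcfI:
  assumes h: "hom_poly m h" "h p0 \<noteq> 0"
    and "\<And>n p. p \<in> crit_locus F \<Longrightarrow> h ((F ^^ n) p) = 0"
  shows "pcf F"
proof -
  obtain cf where cf: "h = hom_eval m cf"
    using h by (auto simp: hom_poly_def)
  have "nonzero_hom m cf"
  proof (rule ccontr)
    assume "\<not> nonzero_hom m cf"
    then have "cf i j = 0" if "i \<le> m" "j \<le> m - i" for i j
      using that by (auto simp: nonzero_hom_def)
    then have "hom_eval m cf p0 = 0" by (simp add: hom_eval_def)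
    with h cf show False by simp
  qed
  with assms cf show ?thesis by (auto simp: pcf_def)
qed

lemma pcfI_invariant:
  assumes h: "hom_poly m h" "h p0 \<noteq> 0"
    and crit: "\<And>p. p \<in> crit_locus F \<Longrightarrow> h p = 0"
    and inv: "\<And>p. h p = 0 \<Longrightarrow> h (F p) = 0"
  shows "pcf F"
proof (rule pcfI[OF h])
  fix n p assume p: "p \<in> crit_locus F"
  show "h ((F ^^ n) p) = 0"
    by (induction n) (use crit[OF p] inv in auto)
qed

section \<open>Bivariate polynomials and the affine chart\<close>

text \<open>The outer variable is x; the coefficients are polynomials in y.\<close>

definition ev2 :: "complex poly poly \<Rightarrow> complex \<Rightarrow> complex \<Rightarrow> complex" where
  "ev2 P x y = poly (poly P [:x:]) y"

text \<open>Over the domain of polynomials in y, \<open>P\<close> has only finitely many roots, so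
  some constant \<open>[:x:]\<close> is not a root.\<close>

lemma ev2_nonzero:
  assumes "P \<noteq> 0"
  shows "\<exists>x y. ev2 P x y \<noteq> 0"
proof -
  have "\<not> range (\<lambda>x::complex. [:x:]) \<subseteq> {q. poly P q = 0}"
  proof
    assume "range (\<lambda>x::complex. [:x:]) \<subseteq> {q. poly P q = 0}"
    with poly_roots_finite[OF assms] have "finite (range (\<lambda>x::complex. [:x:]))"
      by (rule rev_finite_subset)
    moreover have "inj (\<lambda>x::complex. [:x:])" by (rule injI) simp
    ultimately show False
      using finite_imageD infinite_UNIV_char_0 by blast
  qed
  then obtain x where "poly P [:x:] \<noteq> 0" by auto
  then show ?thesis
    unfolding ev2_def by (metis poly_all_0_iff_0)
qed

lemma hom_eval_nonzero:
  assumes "nonzero_hom m cf"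
  shows "\<exists>x y. hom_eval m cf (vector [x, y, 1]) \<noteq> 0"
proof -
  define P where "P = (\<Sum>i\<le>m. monom (\<Sum>j\<le>m - i. monom (cf i j) j) i)"
  obtain i j where ij: "i + j \<le> m" "cf i j \<noteq> 0"
    using assms by (auto simp: nonzero_hom_def)
  have "coeff (coeff P i) j = cf i j"
    using ij by (simp add: P_def coeff_sum if_distrib[of "\<lambda>p. coeff p j"] cong: if_cong)
  then have "P \<noteq> 0" using ij by auto
  moreover have "ev2 P x y = hom_eval m cf (vector [x, y, 1])" for x y
    by (simp add: ev2_def P_def hom_eval_def poly_sum poly_monom)
       (simp add: sum_distrib_left mult.commute mult.left_commute)
  ultimately show ?thesis using ev2_nonzero by metis
qed

text \<open>Recentres the affine chart; \<open>s = a / 2\<close> and \<open>r = d / 2\<close> will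
  give the normal form.\<close>

lemma hom_eval_shift:
  assumes "nonzero_hom m cf"
  obtains P where "P \<noteq> 0" "\<And>x y. ev2 P x y = hom_eval m cf (vector [x - s, y - r, 1])"
proof
  define P where "P = (\<Sum>i\<le>m. \<Sum>j\<le>m - i. [:[:cf i j:]:] * [:[:-s:], 1:] ^ i * [:[:-r, 1:]:] ^ j)"
  show ev: "ev2 P x y = hom_eval m cf (vector [x - s, y - r, 1])" for x y
    by (simp add: ev2_def P_def hom_eval_def poly_sum mult_ac)
  obtain x y where "hom_eval m cf (vector [x, y, 1]) \<noteq> 0"
    using hom_eval_nonzero[OF assms] by blast
  then have "ev2 P (x + s) (y + r) \<noteq> 0" by (simp add: ev)
  then show "P \<noteq> 0" by (auto simp: ev2_def)
qed

section \<open>Derivative and critical locus\<close>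

definition fmap_deriv ::
    "complex \<Rightarrow> complex \<Rightarrow> complex \<Rightarrow> complex \<Rightarrow> complex^3 \<Rightarrow> complex^3 \<Rightarrow> complex^3" where
  "fmap_deriv a b c d p v = vector
     [2 * p$1 * v$1 + a * (p$1 * v$3 + v$1 * p$3) + b * (p$2 * v$3 + v$2 * p$3),
      2 * p$2 * v$2 + c * (p$1 * v$3 + v$1 * p$3) + d * (p$2 * v$3 + v$2 * p$3),
      2 * p$3 * v$3]"

lemma fmap_nth:
  "fmap a b c d p $ 1 = (p$1)^2 + a * p$1 * p$3 + b * p$2 * p$3"
  "fmap a b c d p $ 2 = (p$2)^2 + c * p$1 * p$3 + d * p$2 * p$3"
  "fmap a b c d p $ 3 = (p$3)^2"
  by (simp_all add: fmap_def)

lemma fmap_deriv_nth: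
  "fmap_deriv a b c d p v $ 1 = 2 * p$1 * v$1 + a * (p$1 * v$3 + v$1 * p$3) + b * (p$2 * v$3 + v$2 * p$3)"
  "fmap_deriv a b c d p v $ 2 = 2 * p$2 * v$2 + c * (p$1 * v$3 + v$1 * p$3) + d * (p$2 * v$3 + v$2 * p$3)"
  "fmap_deriv a b c d p v $ 3 = 2 * p$3 * v$3"
  by (simp_all add: fmap_deriv_def)

lemma has_derivative_fmap: "(fmap a b c d has_derivative fmap_deriv a b c d p) (at p)"
proof -
  have nth: "((\<lambda>p::complex^3. p$i) has_derivative (\<lambda>v. v$i)) (at p)" for i
    by (rule bounded_linear_imp_has_derivative) (rule bounded_linear_vec_nth)
  have "((\<lambda>p. fmap a b c d p $ i) has_derivative (\<lambda>v. fmap_deriv a b c d p v $ i)) (at p)" for i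
    using exhaust_3[of i]
    by (elim disjE)
      (auto simp: fmap_nth fmap_deriv_nth power2_eq_square algebra_simps
        intro!: derivative_eq_intros nth)
  then show ?thesis
    by (subst has_derivative_componentwise_within)
       (auto simp: Basis_vec_def inner_axis intro!: has_derivative_inner_left)
qed


lemma vec3_eq_iff: "(v::complex^3) = w \<longleftrightarrow> v$1 = w$1 \<and> v$2 = w$2 \<and> v$3 = w$3"
  by (simp add: vec_eq_iff forall_3)

lemma crit_locus_fmap_kernel:
  "p \<in> crit_locus (fmap a b c d) \<longleftrightarrow> p \<noteq> 0 \<and> (\<exists>v. v \<noteq> 0 \<and> fmap_deriv a b c d p v = 0)"
proof -
  have "(\<forall>D. (fmap a b c d has_derivative D) (at p) \<longrightarrow> \<not> inj D) \<longleftrightarrow> \<not> inj (fmap_deriv a b c d p)"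
    using has_derivative_fmap has_derivative_unique by blast
  moreover have "linear (fmap_deriv a b c d p)"
    using has_derivative_fmap has_derivative_linear by blast
  ultimately show ?thesis
    by (auto simp: crit_locus_def linear_injective_0)
qed

text \<open>The Jacobian determinant of the lift is \<open>2 * p$3\<close> times the difference of
  the two sides of the displayed equation. The proof works with explicit kernel vectors.\<close>

lemma crit_locus_fmap:
  "p \<in> crit_locus (fmap a b c d) \<longleftrightarrow>
    p \<noteq> 0 \<and> (p$3 = 0 \<or> (2 * p$1 + a * p$3) * (2 * p$2 + d * p$3) = b * c * (p$3)^2)"
  (is "_ \<longleftrightarrow> _ \<and> (_ \<or> ?J)")
proof -
  have "p$3 = 0 \<or> ?J" if v: "v \<noteq> 0" "fmap_deriv a b c d p v = 0" for v
  proof (cases "p$3 = 0")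
    case p3: False
    from v(2) p3 have v3: "v$3 = 0"
      by (simp add: vec3_eq_iff fmap_deriv_nth)
    have "2 * p$1 * v$1 + a * v$1 * p$3 + b * v$2 * p$3 = 0"
        "2 * p$2 * v$2 + c * v$1 * p$3 + d * v$2 * p$3 = 0"
      using v(2) v3 by (simp_all add: vec3_eq_iff fmap_deriv_nth mult.assoc)
    then have e: "(2 * p$1 + a * p$3) * v$1 = - b * p$3 * v$2"
        "(2 * p$2 + d * p$3) * v$2 = - c * p$3 * v$1"
      by algebra+
    have "v$1 \<noteq> 0 \<or> v$2 \<noteq> 0" using v(1) v3 by (simp add: vec3_eq_iff)
    moreover have "((2 * p$1 + a * p$3) * (2 * p$2 + d * p$3) - b * c * (p$3)^2) * v$1 = 0"
      using e by algebra
    moreover have "((2 * p$1 + a * p$3) * (2 * p$2 + d * p$3) - b * c * (p$3)^2) * v$2 = 0"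
      using e by algebra
    ultimately show ?thesis by auto
  qed simp
  moreover have "\<exists>v. v \<noteq> 0 \<and> fmap_deriv a b c d p v = 0" if "p$3 = 0 \<or> ?J"
  proof (cases "p$3 = 0")
    case True
    consider "p$1 = 0" | "p$2 = 0" | "p$1 \<noteq> 0" "p$2 \<noteq> 0" by blast
    then show ?thesis
    proof cases
      case 1
      then show ?thesis using True
        by (intro exI[of _ "vector [1, 0, 0]"]) (simp add: vec3_eq_iff fmap_deriv_nth vector_3)
    next
      case 2
      then show ?thesis using True
        by (intro exI[of _ "vector [0, 1, 0]"]) (simp add: vec3_eq_iff fmap_deriv_nth vector_3)
    next
      case 3
      then show ?thesis using True
        by (intro exI[of _ "vector [- (a * p$1 + b * p$2) / (2 * p$1),
               - (c * p$1 + d * p$2) / (2 * p$2), 1]"])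
           (simp add: vec3_eq_iff fmap_deriv_nth vector_3 field_simps)
    qed
  next
    case False
    with that have J: ?J by blast
    \<comment> \<open>A nonzero column of the adjugate of the upper left 2 by 2 block gives a kernel
      vector. The first case is where one column vanishes; if both do, the block itself is
      zero.\<close>
    consider "b = 0" "2 * p$1 + a * p$3 = 0" | "b \<noteq> 0 \<or> 2 * p$1 + a * p$3 \<noteq> 0" by blast
    then show ?thesis
    proof cases
      case 1
      show ?thesis
      proof (cases "c = 0 \<and> 2 * p$2 + d * p$3 = 0")
        case True
        with 1 have "fmap_deriv a b c d p (vector [1, 0, 0]) = 0"
          by (simp add: vec3_eq_iff fmap_deriv_nth vector_3)
        then show ?thesis
          by (intro exI[of _ "vector [1, 0, 0]"]) (simp add: vec3_eq_iff vector_3)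
      next
        case nz: False
        have "2 * p$1 * (2 * p$2 + d * p$3) + a * ((2 * p$2 + d * p$3) * p$3) = 0"
          using 1(2) by algebra
        then have "fmap_deriv a b c d p (vector [2 * p$2 + d * p$3, - c * p$3, 0]) = 0"
          by (simp add: vec3_eq_iff fmap_deriv_nth vector_3 1(1)) (simp add: algebra_simps)
        then show ?thesis using nz False
          by (intro exI[of _ "vector [2 * p$2 + d * p$3, - c * p$3, 0]"])
             (auto simp: vec3_eq_iff vector_3)
      qed
    next
      case 2
      have "fmap_deriv a b c d p (vector [- b * p$3, 2 * p$1 + a * p$3, 0]) = 0"
        using J by (simp add: vec3_eq_iff fmap_deriv_nth vector_3) (simp add: algebra_simps power2_eq_square)
      then show ?thesis using 2 False
        by (intro exI[of _ "vector [- b * p$3, 2 * p$1 + a * p$3, 0]"])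
           (auto simp: vec3_eq_iff vector_3)
    qed
  qed
  ultimately show ?thesis unfolding crit_locus_fmap_kernel by blast
qed

section \<open>Expansion of the quadratic lift and conjugacy\<close>

lemma fmap_add_scale:
  "fmap a b c d (p + s *s v) = fmap a b c d p + s *s fmap_deriv a b c d p v + s^2 *s fmap a b c d v"
  by (simp add: vec3_eq_iff fmap_nth fmap_deriv_nth power2_eq_square algebra_simps)

lemma fmap_scale: "fmap a b c d (l *s p) = l^2 *s fmap a b c d p"
  by (simp add: vec3_eq_iff fmap_nth power2_eq_square algebra_simps)

lemma fmap_deriv_self: "fmap_deriv a b c d p p = 2 *s fmap a b c d p"
  by (simp add: vec3_eq_iff fmap_nth fmap_deriv_nth power2_eq_square algebra_simps)

lemma fmap_deriv_diff_scale:
  "fmap_deriv a b c d p (v - s *s w) = fmap_deriv a b c d p v - s *s fmap_deriv a b c d p w"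
  by (simp add: vec3_eq_iff fmap_deriv_nth algebra_simps)

lemma fmap_eq_0_iff: "fmap a b c d p = 0 \<longleftrightarrow> p = 0"
  by (auto simp: vec3_eq_iff fmap_nth)

lemma fmap_iterate_nonzero: "p \<noteq> 0 \<Longrightarrow> (fmap a b c d ^^ n) p \<noteq> 0"
  by (induction n) (simp_all add: fmap_eq_0_iff)

text \<open>The scaling factor in a conjugacy depends on the point, so it cannot be differentiated
  directly. Instead, the identities \<open>H\<^sub>i G\<^sub>j = H\<^sub>j G\<^sub>i\<close> between coordinates are expanded to
  first order along a kernel vector of the one derivative; Euler's relation then corrects this
  vector to a kernel vector of the other.\<close>

lemma crit_locus_conj:
  assumes M: "N ** M = mat 1" "M ** N = mat 1"
    and conj: "\<And>p. p \<noteq> 0 \<Longrightarrow> \<exists>l. l \<noteq> 0 \<and> fmap a b c d (M *v p) = l *s (M *v fmap a' b' c' d' p)"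
    and crit: "M *v p \<in> crit_locus (fmap a b c d)"
  shows "p \<in> crit_locus (fmap a' b' c' d')"
proof -
  let ?F = "fmap a b c d" and ?G = "fmap a' b' c' d'"
  define H where "H q = N *v ?F (M *v q)" for q
  have NM: "N *v (M *v q) = q" "M *v (N *v q) = q" for q
    using M by (simp_all add: matrix_vector_mul_assoc)
  obtain v where v: "v \<noteq> 0" "fmap_deriv a b c d (M *v p) v = 0" and Mp: "M *v p \<noteq> 0"
    using crit by (auto simp: crit_locus_fmap_kernel)
  have p: "p \<noteq> 0" using Mp by auto
  define w where "w = N *v v"
  have w: "v = M *v w" by (simp add: w_def NM)
  have HG: "\<exists>l. H q = l *s ?G q \<and> (q \<noteq> 0 \<longrightarrow> l \<noteq> 0)" for q
  proof (cases "q = 0")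
    case True
    then show ?thesis by (intro exI[of _ 1]) (simp add: H_def fmap_eq_0_iff[THEN iffD2])
  next
    case False
    from conj[OF this] show ?thesis
      by (auto simp: H_def NM vector_scalar_commute)
  qed
  \<comment> \<open>The term linear in \<open>s\<close> is absent because \<open>v\<close> lies in
    the kernel of the derivative.\<close>
  have Hs: "H (p + s *s w) = H p + s^2 *s H w" for s
    by (simp add: H_def matrix_vector_right_distrib vector_scalar_commute fmap_add_scale
        flip: w) (simp add: v)
  define E where "E = fmap_deriv a' b' c' d' p w"
  have comm: "H p $ i * E $ j = H p $ j * E $ i" for i j
  proof -
    \<comment> \<open>The expansion in powers of \<open>s\<close> of the coordinate identity at
      \<open>p + s *s w\<close>; its linear coefficient is the claim.\<close>
    let ?q = "[:H p$i * ?G p$j - H p$j * ?G p$i,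
               H p$i * E$j - H p$j * E$i,
               H p$i * ?G w$j + H w$i * ?G p$j - H p$j * ?G w$i - H w$j * ?G p$i,
               H w$i * E$j - H w$j * E$i,
               H w$i * ?G w$j - H w$j * ?G w$i:]"
    have "poly ?q s = 0" for s
    proof -
      obtain l where l: "H (p + s *s w) = l *s ?G (p + s *s w)" using HG by blast
      have "H (p + s *s w) $ i * ?G (p + s *s w) $ j = H (p + s *s w) $ j * ?G (p + s *s w) $ i"
        by (simp add: l)
      then show ?thesis
        unfolding Hs fmap_add_scale E_def[symmetric]
        by (simp add: algebra_simps power2_eq_square)
    qed
    then have "?q = 0" by (simp only: poly_all_0_iff_0[symmetric]) blast
    then show ?thesis by simp
  qed
  obtain l where l: "H p = l *s ?G p" "l \<noteq> 0" using HG p by blast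
  have "?G p \<noteq> 0" using p by (simp add: fmap_eq_0_iff)
  then obtain i where i: "?G p $ i \<noteq> 0" by (auto simp: vec_eq_iff)
  define k where "k = E $ i / (2 * ?G p $ i)"
  have "E = (2 * k) *s ?G p"
    unfolding vec_eq_iff
  proof
    fix j
    show "E $ j = ((2 * k) *s ?G p) $ j"
      using comm[of i j] i l by (simp add: k_def field_simps)
  qed
  then have "fmap_deriv a' b' c' d' p (w - k *s p) = 0"
    by (simp add: fmap_deriv_diff_scale fmap_deriv_self flip: E_def)
  moreover have "w - k *s p \<noteq> 0"
  proof
    assume "w - k *s p = 0"
    then have vk: "v = k *s (M *v p)" by (simp add: w vector_scalar_commute)
    have "fmap_deriv a b c d (M *v p) v = (2 * k) *s ?F (M *v p)"
      by (simp add: vk vec3_eq_iff fmap_nth fmap_deriv_nth power2_eq_square algebra_simps)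
    with v have "k = 0 \<or> ?F (M *v p) = 0" by simp
    with v(1) vk Mp show False by (auto simp: fmap_eq_0_iff)
  qed
  ultimately show ?thesis using p unfolding crit_locus_fmap_kernel by blast
qed

text \<open>The curve is transported by the inverse matrix. The conjugacy matches orbits only up to
  scalars, which homogeneity absorbs.\<close>

lemma pcf_proj_conj:
  assumes "pcf (fmap a' b' c' d')" "proj_conj (fmap a b c d) (fmap a' b' c' d')"
  shows "pcf (fmap a b c d)"
proof -
  let ?F = "fmap a b c d" and ?G = "fmap a' b' c' d'"
  obtain m cf where cf: "nonzero_hom m cf"
      "\<And>n p. p \<in> crit_locus ?G \<Longrightarrow> hom_eval m cf ((?G ^^ n) p) = 0"
    using assms(1) by (auto simp: pcf_def)
  obtain M where "invertible M" and
    conj: "\<And>p. p \<noteq> 0 \<Longrightarrow> \<exists>l. l \<noteq> 0 \<and> ?F (M *v p) = l *s (M *v ?G p)"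
    using assms(2) by (auto simp: proj_conj_def)
  then obtain N where N: "N ** M = mat 1" "M ** N = mat 1"
    by (auto simp: invertible_def)
  have NM: "N *v (M *v q) = q" "M *v (N *v q) = q" for q
    using N by (simp_all add: matrix_vector_mul_assoc)
  have hp: "hom_poly m (hom_eval m cf)" by (auto simp: hom_poly_def)
  obtain x y where "hom_eval m cf (vector [x, y, 1]) \<noteq> 0"
    using hom_eval_nonzero[OF cf(1)] by blast
  then have nz: "hom_eval m cf (N *v (M *v vector [x, y, 1])) \<noteq> 0" by (simp add: NM)
  show ?thesis
  proof (rule pcfI[OF hom_poly_linear_subst[OF hp] nz])
    fix n q assume q: "q \<in> crit_locus ?F"
    define p where "p = N *v q"
    have qp: "q = M *v p" by (simp add: p_def NM)
    have p: "p \<in> crit_locus ?G"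
      using crit_locus_conj[OF N conj, of p] q unfolding qp by blast
    then have p0: "p \<noteq> 0" by (simp add: crit_locus_def)
    have "\<exists>l. (?F ^^ n) q = l *s (M *v (?G ^^ n) p)"
    proof (induction n)
      case 0
      show ?case by (rule exI[of _ 1]) (simp add: qp)
    next
      case (Suc n)
      then obtain l where l: "(?F ^^ n) q = l *s (M *v (?G ^^ n) p)" by blast
      obtain k where "?F (M *v (?G ^^ n) p) = k *s (M *v ?G ((?G ^^ n) p))"
        using conj[OF fmap_iterate_nonzero[OF p0]] by blast
      then show ?case
        by (intro exI[of _ "l^2 * k"]) (simp add: l fmap_scale)
    qed
    then obtain l where "(?F ^^ n) q = l *s (M *v (?G ^^ n) p)" by blast
    then have "hom_eval m cf (N *v (?F ^^ n) q) = l ^ m * hom_eval m cf ((?G ^^ n) p)"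
      by (simp add: vector_scalar_commute NM hom_poly_scaleC[OF hp])
    then show "hom_eval m cf (N *v (?F ^^ n) q) = 0" using cf(2)[OF p] by simp
  qed
qed

section \<open>Invariant curves for the six listed maps\<close>

lemmas hom_poly_intros =
  hom_poly_coord hom_poly_scale hom_poly_diff hom_poly_add hom_poly_mult

lemma pcf_squaring: "pcf (fmap 0 0 0 0)"
proof (rule pcfI_invariant)
  show "hom_poly (1 + (1 + 1)) (\<lambda>p. p$3 * (p$1 * p$2))"
    by (rule hom_poly_intros)+
  show "(vector [1, 1, 1] :: complex^3) $ 3 *
      ((vector [1, 1, 1] :: complex^3) $ 1 * (vector [1, 1, 1] :: complex^3) $ 2) \<noteq> 0"
    by (simp add: vector_3)
qed (auto simp: crit_locus_fmap fmap_nth)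

text \<open>In the second coordinate the map is y^2 - 2 y, with critical orbit 1, -1, 3, 3.\<close>

lemma pcf_0_0_0_m2: "pcf (fmap 0 0 0 (-2))"
proof (rule pcfI_invariant)
  let ?h = "\<lambda>p::complex^3. p$3 * (p$1 * ((p$2 - p$3) * ((p$2 + p$3) * (p$2 - 3 * p$3))))"
  show "hom_poly (1 + (1 + (1 + (1 + 1)))) ?h"
    by (rule hom_poly_intros)+
  show "?h (vector [1, 0, 1]) \<noteq> 0" by (simp add: vector_3)
  show "?h p = 0" if "p \<in> crit_locus (fmap 0 0 0 (-2))" for p
    using that by (auto simp: crit_locus_fmap)
  show "?h (fmap 0 0 0 (-2) p) = 0" if z: "?h p = 0" for p
  proof -
    consider "p$3 = 0" | "p$1 = 0" | "p$2 = p$3" | "p$2 = - p$3" | "p$2 = 3 * p$3"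
      using z by (auto simp: add_eq_0_iff)
    then show ?thesis by cases (auto simp: fmap_nth power2_eq_square)
  qed
qed

lemma pcf_m2_0_0_m2: "pcf (fmap (-2) 0 0 (-2))"
proof (rule pcfI_invariant)
  let ?h = "\<lambda>p::complex^3. p$3 * (((p$1 - p$3) * ((p$1 + p$3) * (p$1 - 3 * p$3))) *
     ((p$2 - p$3) * ((p$2 + p$3) * (p$2 - 3 * p$3))))"
  show "hom_poly (1 + ((1 + (1 + 1)) + (1 + (1 + 1)))) ?h"
    by (rule hom_poly_intros)+
  show "?h (vector [0, 0, 1]) \<noteq> 0" by (simp add: vector_3)
  show "?h p = 0" if "p \<in> crit_locus (fmap (-2) 0 0 (-2))" for p
    using that by (auto simp: crit_locus_fmap)
  show "?h (fmap (-2) 0 0 (-2) p) = 0" if z: "?h p = 0" for p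
  proof -
    consider "p$3 = 0" | "p$1 = p$3" | "p$1 = - p$3" | "p$1 = 3 * p$3"
      | "p$2 = p$3" | "p$2 = - p$3" | "p$2 = 3 * p$3"
      using z by (auto simp: add_eq_0_iff)
    then show ?thesis by cases (auto simp: fmap_nth power2_eq_square)
  qed
qed

text \<open>The line y = 0 and the parabola y^2 = x are mapped into each other.\<close>

lemma pcf_0_0_m1_0: "pcf (fmap 0 0 (-1) 0)"
proof (rule pcfI_invariant)
  let ?h = "\<lambda>p::complex^3. p$3 * (p$1 * (p$2 * (p$2 * p$2 - p$1 * p$3)))"
  show "hom_poly (1 + (1 + (1 + (1 + 1)))) ?h"
    by (rule hom_poly_intros)+
  show "?h (vector [1, 2, 1]) \<noteq> 0" by (simp add: vector_3)
  show "?h p = 0" if "p \<in> crit_locus (fmap 0 0 (-1) 0)" for p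
    using that by (auto simp: crit_locus_fmap)
  show "?h (fmap 0 0 (-1) 0 p) = 0" if z: "?h p = 0" for p
  proof -
    consider "p$3 = 0" | "p$1 = 0" | "p$2 = 0" | "p$2 * p$2 = p$1 * p$3"
      using z by auto
    then show ?thesis by cases (auto simp: fmap_nth power2_eq_square)
  qed
qed

text \<open>The line y = 0 is mapped into the parabola y^2 = 4 x, which is mapped into
  itself.\<close>

lemma pcf_0_0_m2_0: "pcf (fmap 0 0 (-2) 0)"
proof (rule pcfI_invariant)
  let ?h = "\<lambda>p::complex^3. p$3 * (p$1 * (p$2 * (p$2 * p$2 - 4 * (p$1 * p$3))))"
  show "hom_poly (1 + (1 + (1 + (1 + 1)))) ?h"
    by (rule hom_poly_intros)+
  show "?h (vector [1, 1, 1]) \<noteq> 0" by (simp add: vector_3)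
  show "?h p = 0" if "p \<in> crit_locus (fmap 0 0 (-2) 0)" for p
    using that by (auto simp: crit_locus_fmap)
  show "?h (fmap 0 0 (-2) 0 p) = 0" if z: "?h p = 0" for p
  proof -
    consider "p$3 = 0" | "p$1 = 0" | "p$2 = 0" | "p$2 * p$2 = 4 * (p$1 * p$3)"
      using z by auto
    then show ?thesis by cases (auto simp: fmap_nth power2_eq_square)
  qed
qed

text \<open>The map sends the elementary symmetric functions \<open>(e\<^sub>1, e\<^sub>2)\<close> of \<open>u, v, w\<close> with
  \<open>u v w = 1\<close> to those of the squares. So the last factor, the discriminant of the cubic
  \<open>T\<^sup>3 - x T\<^sup>2 + y T - 1\<close>, is multiplied by the square of \<open>(u + v) (v + w) (w + u) = x y - 1\<close>.\<close>

lemma pcf_0_m2_m2_0: "pcf (fmap 0 (-2) (-2) 0)"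
proof (rule pcfI_invariant)
  let ?D = "\<lambda>p::complex^3. (p$1 * p$2) * (p$1 * p$2) - 4 * ((p$1 * p$1) * (p$1 * p$3))
     - 4 * ((p$2 * p$2) * (p$2 * p$3)) + 18 * ((p$1 * p$2) * (p$3 * p$3))
     - 27 * ((p$3 * p$3) * (p$3 * p$3))"
  let ?h = "\<lambda>p::complex^3. p$3 * ((p$1 * p$2 - p$3 * p$3) * ?D p)"
  show "hom_poly (1 + ((1 + 1) + ((1 + 1) + (1 + 1)))) ?h"
    by (rule hom_poly_intros)+
  show "?h (vector [0, 0, 1]) \<noteq> 0" by (simp add: vector_3)
  show "?h p = 0" if "p \<in> crit_locus (fmap 0 (-2) (-2) 0)" for p
    using that by (auto simp: crit_locus_fmap power2_eq_square)
  show "?h (fmap 0 (-2) (-2) 0 p) = 0" if "?h p = 0" for p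
  proof -
    have "?D (fmap 0 (-2) (-2) 0 p) = ?D p * (p$1 * p$2 - p$3 * p$3)^2"
      by (simp add: fmap_nth) algebra
    with that show ?thesis by (auto simp: fmap_nth)
  qed
qed

lemma pcf_of_pcf_list:
  assumes "(a, b, c, d) \<in> pcf_list"
  shows "pcf (fq a b c d)"
  using assms pcf_squaring pcf_0_0_0_m2 pcf_m2_0_0_m2 pcf_0_0_m1_0 pcf_0_0_m2_0 pcf_0_m2_m2_0
  by (auto simp: pcf_list_def fq_def)

section \<open>Growth at infinity and the Newton polygon\<close>

text \<open>As \<open>l\<close> may be 0, \<open>k\<close> is in general only an upper bound for the
  order; it is the exact order when \<open>l\<close> is nonzero.\<close>

definition growth :: "(complex \<Rightarrow> complex) \<Rightarrow> nat \<Rightarrow> complex \<Rightarrow> bool" where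
  "growth h k l \<longleftrightarrow> ((\<lambda>t. h t / t ^ k) \<longlongrightarrow> l) at_infinity"

lemma growth_cong:
  assumes "growth g k l" "\<And>t. t \<noteq> 0 \<Longrightarrow> f t = g t"
  shows "growth f k l"
proof -
  have "eventually (\<lambda>t::complex. t \<noteq> 0) at_infinity"
    using eventually_not_equal_at_infinity by blast
  then have "eventually (\<lambda>t. g t / t ^ k = f t / t ^ k) at_infinity"
    by eventually_elim (simp add: assms)
  then show ?thesis
    using assms(1) unfolding growth_def by (rule Lim_transform_eventually[rotated])
qed

lemma growth_eqI:
  assumes "growth g k l" "k = j" "l = m" "\<And>t. t \<noteq> 0 \<Longrightarrow> f t = g t"
  shows "growth f j m"
  using growth_cong[of g k l f] assms by simp

lemma growth_const: "growth (\<lambda>t. c) 0 c"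
  by (simp add: growth_def)

lemma growth_ident: "growth (\<lambda>t. t) 1 1"
  unfolding growth_def
  by (rule Lim_transform_eventually[OF tendsto_const],
      rule eventually_mono[OF eventually_not_equal_at_infinity[of 0]]) simp

lemma growth_inverse: "growth (\<lambda>t. s / t) 0 0"
  using tendsto_mult[OF tendsto_const[of s] tendsto_inverse_0]
  by (simp add: growth_def divide_inverse)

lemma growth_zero: "growth (\<lambda>t. 0) k 0"
  by (simp add: growth_def)

lemma growth_add: "growth f k l \<Longrightarrow> growth g k m \<Longrightarrow> growth (\<lambda>t. f t + g t) k (l + m)"
  unfolding growth_def by (simp add: add_divide_distrib tendsto_add)

lemma growth_mult: "growth f k l \<Longrightarrow> growth g j m \<Longrightarrow> growth (\<lambda>t. f t * g t) (k + j) (l * m)"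
  unfolding growth_def by (drule (1) tendsto_mult) (simp add: power_add)

lemma growth_scale: "growth f k l \<Longrightarrow> growth (\<lambda>t. c * f t) k (c * l)"
  using growth_mult[OF growth_const] by fastforce

lemma growth_power: "growth f k l \<Longrightarrow> growth (\<lambda>t. f t ^ n) (n * k) (l ^ n)"
  by (induction n) (simp_all add: growth_const growth_mult)

lemma growth_lift:
  assumes "growth f k l" "k < j"
  shows "growth f j 0"
proof -
  have "((\<lambda>t::complex. inverse t ^ (j - k)) \<longlongrightarrow> 0) at_infinity"
    using tendsto_power[OF tendsto_inverse_0, of "j - k"] assms(2)
    by (auto simp: power_0_left)
  with assms(1) have "((\<lambda>t. f t / t ^ k * inverse t ^ (j - k)) \<longlongrightarrow> l * 0) at_infinity"
    unfolding growth_def by (rule tendsto_mult)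
  moreover have "f t / t ^ k * inverse t ^ (j - k) = f t / t ^ j" for t
  proof -
    have "t ^ j = t ^ k * t ^ (j - k)" using assms(2) by (simp flip: power_add)
    then show ?thesis by (simp add: field_simps)
  qed
  ultimately show ?thesis by (simp add: growth_def)
qed

text \<open>Exponents are natural numbers, so decay like 1/t is expressed through
  \<open>t * h t\<close>.\<close>

lemma growth_mult_decay:
  assumes "growth f (Suc k) l" "growth (\<lambda>t. t * h t) 0 m"
  shows "growth (\<lambda>t. f t * h t) k (l * m)"
proof -
  have "growth (\<lambda>t. f t * (t * h t)) (Suc k) (l * m)"
    using growth_mult[OF assms] by simp
  then have "((\<lambda>t. f t * (t * h t) / t ^ Suc k) \<longlongrightarrow> l * m) at_infinity"
    by (simp add: growth_def)
  moreover have "eventually (\<lambda>t. f t * (t * h t) / t ^ Suc k = f t * h t / t ^ k) at_infinity"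
    using eventually_not_equal_at_infinity[of 0] by eventually_elim simp
  ultimately show ?thesis
    unfolding growth_def by (rule Lim_transform_eventually)
qed

section \<open>The Newton polygon\<close>

definition supp :: "complex poly poly \<Rightarrow> (nat \<times> nat) set" where
  "supp P = {(i, j). coeff (coeff P i) j \<noteq> 0}"

lemma supp_subset: "supp P \<subseteq> Sigma {..degree P} (\<lambda>i. {..degree (coeff P i)})"
  by (auto simp: supp_def intro: le_degree)

lemma finite_supp: "finite (supp P)"
  by (rule finite_subset[OF supp_subset]) auto

lemma supp_nonempty: "P \<noteq> 0 \<Longrightarrow> supp P \<noteq> {}"
  by (auto simp: supp_def poly_eq_iff)

lemma ev2_supp: "ev2 P x y = (\<Sum>(i, j)\<in>supp P. coeff (coeff P i) j * x ^ i * y ^ j)"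
proof -
  have "ev2 P x y = (\<Sum>i\<le>degree P. \<Sum>j\<le>degree (coeff P i). coeff (coeff P i) j * x ^ i * y ^ j)"
    unfolding ev2_def poly_altdef[of P] poly_sum poly_mult poly_power
    by (simp add: poly_altdef sum_distrib_left mult_ac)
  also have "\<dots> = (\<Sum>(i, j)\<in>Sigma {..degree P} (\<lambda>i. {..degree (coeff P i)}).
      coeff (coeff P i) j * x ^ i * y ^ j)"
    by (rule sum.Sigma) auto
  also have "\<dots> = (\<Sum>(i, j)\<in>supp P. coeff (coeff P i) j * x ^ i * y ^ j)"
    by (rule sum.mono_neutral_right[OF _ supp_subset]) (auto simp: supp_def)
  finally show ?thesis .
qed

text \<open>The support points on the face of the Newton polygon selected by weight \<open>A\<close>
  for x and \<open>B\<close> for y.\<close>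

definition lead_supp :: "complex poly poly \<Rightarrow> nat \<Rightarrow> nat \<Rightarrow> (nat \<times> nat) set" where
  "lead_supp P A B = {(i, j) \<in> supp P. \<forall>(i', j') \<in> supp P. A * i' + B * j' \<le> A * i + B * j}"

lemma lead_supp_subset: "lead_supp P A B \<subseteq> supp P"
  by (auto simp: lead_supp_def)

lemma lead_supp_nonempty:
  assumes "P \<noteq> 0"
  shows "lead_supp P A B \<noteq> {}"
proof -
  let ?f = "\<lambda>(i, j). A * i + B * j"
  have "Max (?f ` supp P) \<in> ?f ` supp P"
    using finite_supp supp_nonempty[OF assms] by (intro Max_in) auto
  then obtain x where "Max (?f ` supp P) = ?f x" "x \<in> supp P" by (rule imageE)
  moreover have "?f y \<le> Max (?f ` supp P)" if "y \<in> supp P" for y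
    using that finite_supp by (intro Max_ge) auto
  ultimately have "x \<in> lead_supp P A B"
    by (fastforce simp: lead_supp_def split: prod.splits)
  then show ?thesis by auto
qed

lemma lead_supp_weight:
  "(i, j) \<in> lead_supp P A B \<Longrightarrow> (i', j') \<in> lead_supp P A B \<Longrightarrow> A * i + B * j = A * i' + B * j'"
  by (fastforce simp: lead_supp_def)

lemma lead_supp_scale: "K > 0 \<Longrightarrow> lead_supp P (A * K) (B * K) = lead_supp P A B"
proof -
  assume K: "K > 0"
  have "A * K * i' + B * K * j' \<le> A * K * i + B * K * j \<longleftrightarrow> A * i' + B * j' \<le> A * i + B * j"
    for i j i' j'
  proof -
    have "A * K * i' + B * K * j' = K * (A * i' + B * j')" "A * K * i + B * K * j = K * (A * i + B * j)"
      by (simp_all add: algebra_simps)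
    then show ?thesis using K by simp
  qed
  then show ?thesis by (simp add: lead_supp_def)
qed

text \<open>Monomials off the face grow strictly slower, so after division by the maximal power of t
  only the leading form survives in the limit.\<close>

lemma leading_form_zero:
  assumes P: "P \<noteq> 0" and u: "growth u A m" and v: "growth v B l"
    and zero: "\<And>t. t \<noteq> 0 \<Longrightarrow> ev2 P (u t) (v t) = 0"
  shows "(\<Sum>(i, j)\<in>lead_supp P A B. coeff (coeff P i) j * m ^ i * l ^ j) = 0"
proof -
  let ?c = "\<lambda>i j. coeff (coeff P i) j"
  obtain i0 j0 where ij0: "(i0, j0) \<in> lead_supp P A B"
    using lead_supp_nonempty[OF P, of A B] by auto
  define w where "w = A * i0 + B * j0"
  have summand: "growth (\<lambda>t. ?c i j * u t ^ i * v t ^ j) w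
      (if (i, j) \<in> lead_supp P A B then ?c i j * m ^ i * l ^ j else 0)" if "(i, j) \<in> supp P" for i j
  proof -
    have a: "growth (\<lambda>t. ?c i j * u t ^ i * v t ^ j) (A * i + B * j) (?c i j * m ^ i * l ^ j)"
      using growth_scale[OF growth_mult[OF growth_power[OF u, of i] growth_power[OF v, of j]],
        of "?c i j"]
      by (simp add: mult.assoc mult.commute[of A] mult.commute[of B])
    have le: "A * i + B * j \<le> w"
      using that ij0 by (auto simp: lead_supp_def w_def)
    show ?thesis
    proof (cases "(i, j) \<in> lead_supp P A B")
      case True
      then show ?thesis using a lead_supp_weight[OF True ij0] by (simp add: w_def)
    next
      case False
      have "A * i + B * j \<noteq> w"
      proof
        assume "A * i + B * j = w"
        with ij0 that have "(i, j) \<in> lead_supp P A B" by (auto simp: lead_supp_def w_def)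
        with False show False by simp
      qed
      with le have "A * i + B * j < w" by simp
      from growth_lift[OF a this] False show ?thesis by simp
    qed
  qed
  have "((\<lambda>t. \<Sum>x\<in>supp P. (case x of (i, j) \<Rightarrow> ?c i j * u t ^ i * v t ^ j) / t ^ w) \<longlongrightarrow>
      (\<Sum>x\<in>supp P. if x \<in> lead_supp P A B then (case x of (i, j) \<Rightarrow> ?c i j * m ^ i * l ^ j) else 0))
      at_infinity"
  proof (rule tendsto_sum)
    fix x assume "x \<in> supp P"
    then show "((\<lambda>t. (case x of (i, j) \<Rightarrow> ?c i j * u t ^ i * v t ^ j) / t ^ w) \<longlongrightarrow>
      (if x \<in> lead_supp P A B then (case x of (i, j) \<Rightarrow> ?c i j * m ^ i * l ^ j) else 0)) at_infinity"
      using summand[of "fst x" "snd x"]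
      by (cases "x \<in> lead_supp P A B") (simp_all add: growth_def case_prod_unfold)
  qed
  then have "growth (\<lambda>t. ev2 P (u t) (v t)) w
      (\<Sum>x\<in>lead_supp P A B. (case x of (i, j) \<Rightarrow> ?c i j * m ^ i * l ^ j))"
    by (simp add: growth_def ev2_supp sum_divide_distrib sum.inter_restrict[symmetric]
        finite_supp lead_supp_subset Int_absorb1)
  moreover have "growth (\<lambda>t. ev2 P (u t) (v t)) w 0"
    by (rule growth_cong[OF growth_zero]) (simp add: zero)
  ultimately show ?thesis
    unfolding growth_def by (rule tendsto_unique[OF trivial_limit_at_infinity])
qed

text \<open>With nonzero leading coefficients the leading form cannot consist of one monomial. So
  two support points have equal weight, and the ratio of \<open>A\<close> and \<open>B\<close> is
  read off from their differences. Both ratios occur because either exponent may be 0.\<close>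

lemma finite_exponent_ratios:
  assumes P: "P \<noteq> 0"
  shows "\<exists>R :: real set. finite R \<and> (\<forall>u v A B m l. growth u A m \<longrightarrow> growth v B l \<longrightarrow> m \<noteq> 0 \<longrightarrow> l \<noteq> 0 \<longrightarrow>
    (\<forall>t. t \<noteq> 0 \<longrightarrow> ev2 P (u t) (v t) = 0) \<longrightarrow>
    (A > 0 \<longrightarrow> real B / real A \<in> R) \<and> (B > 0 \<longrightarrow> real A / real B \<in> R))"
proof -
  define f where "f = (\<lambda>((i, j), (i', j')). (real i - real i') / (real j' - real j))"
  define R where "R = f ` (supp P \<times> supp P) \<union> (\<lambda>x. inverse (f x)) ` (supp P \<times> supp P)"
  have ratio: "(A > 0 \<longrightarrow> real B / real A \<in> R) \<and> (B > 0 \<longrightarrow> real A / real B \<in> R)"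
    if uv: "growth u A m" "growth v B l" "m \<noteq> 0" "l \<noteq> 0" "\<forall>t. t \<noteq> 0 \<longrightarrow> ev2 P (u t) (v t) = 0"
    for u v A B m l
  proof -
    obtain i j where ij: "(i, j) \<in> lead_supp P A B"
      using lead_supp_nonempty[OF P, of A B] by auto
    have "lead_supp P A B \<noteq> {(i, j)}"
    proof
      assume "lead_supp P A B = {(i, j)}"
      with leading_form_zero[OF P uv(1,2)] uv(5) have "coeff (coeff P i) j * m ^ i * l ^ j = 0"
        by simp
      with uv(3,4) ij show False by (auto simp: lead_supp_def supp_def)
    qed
    with ij obtain i' j' where ij': "(i', j') \<in> lead_supp P A B" "(i', j') \<noteq> (i, j)"
      by auto
    have S: "((i, j), (i', j')) \<in> supp P \<times> supp P"
      using ij ij' lead_supp_subset by blast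
    have "real (A * i + B * j) = real (A * i' + B * j')"
      using lead_supp_weight[OF ij ij'(1)] by simp
    then have eq: "real A * (real i - real i') = real B * (real j' - real j)"
      by (simp add: algebra_simps)
    have "real B / real A \<in> R" if "A > 0"
    proof -
      have "j \<noteq> j'" using eq that ij'(2) by auto
      with eq that have "real B / real A = f ((i, j), (i', j'))"
        by (simp add: f_def field_simps)
      then show ?thesis
        unfolding R_def by (rule UnI1[OF image_eqI[OF _ S]])
    qed
    moreover have "real A / real B \<in> R" if "B > 0"
    proof -
      have "i \<noteq> i'" using eq that ij'(2) by auto
      with eq that have "real A / real B = inverse (f ((i, j), (i', j')))"
        by (simp add: f_def field_simps)
      then show ?thesis
        unfolding R_def by (rule UnI2[OF image_eqI[OF _ S]])
    qed
    ultimately show ?thesis by blast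
  qed
  show ?thesis
  proof (intro exI[of _ R] conjI)
    show "finite R" by (simp add: R_def finite_supp)
  qed (intro allI impI, rule ratio; assumption)
qed

text \<open>When \<open>u\<close> has leading coefficient 1, the leading form is a polynomial in
  \<open>l\<close> alone. It depends only on the direction of the weight, so one \<open>q\<close>
  serves all \<open>K\<close>.\<close>

lemma leading_coefficient_roots:
  assumes P: "P \<noteq> 0" and A: "A > 0"
  shows "\<exists>q. q \<noteq> 0 \<and> (\<forall>u v K l. K > 0 \<longrightarrow> growth u (A * K) 1 \<longrightarrow> growth v (B * K) l \<longrightarrow>
    (\<forall>t. t \<noteq> 0 \<longrightarrow> ev2 P (u t) (v t) = 0) \<longrightarrow> poly q l = 0)"
proof -
  let ?T = "lead_supp P A B"
  define q where "q = (\<Sum>(i, j)\<in>?T. monom (coeff (coeff P i) j) j)"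
  have fin: "finite ?T" using finite_subset[OF lead_supp_subset finite_supp] .
  obtain i0 j0 where ij0: "(i0, j0) \<in> ?T"
    using lead_supp_nonempty[OF P, of A B] by auto
  have "coeff q j0 = (\<Sum>x\<in>?T. if x = (i0, j0) then coeff (coeff P i0) j0 else 0)"
    unfolding q_def coeff_sum
  proof (rule sum.cong[OF refl], clarify)
    fix i j assume ij: "(i, j) \<in> ?T"
    \<comment> \<open>On a face \<open>j\<close> determines \<open>i\<close> because
      \<open>A > 0\<close>, so no two monomials merge when x is set to 1.\<close>
    show "coeff (monom (coeff (coeff P i) j) j) j0 =
        (if (i, j) = (i0, j0) then coeff (coeff P i0) j0 else 0)"
      using lead_supp_weight[OF ij ij0] A by auto
  qed
  also have "\<dots> \<noteq> 0" using ij0 fin by (auto simp: lead_supp_def supp_def)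
  finally have "q \<noteq> 0" by auto
  moreover have "poly q l = 0"
    if "K > 0" "growth u (A * K) 1" "growth v (B * K) l" "\<forall>t. t \<noteq> 0 \<longrightarrow> ev2 P (u t) (v t) = 0"
    for u v K l
    using leading_form_zero[OF P that(2,3)] that(1,4)
    by (simp add: lead_supp_scale q_def poly_sum poly_monom case_prod_unfold)
  ultimately show ?thesis by blast
qed

section \<open>Unicritical polynomials\<close>

text \<open>The orbit of the critical point of z^2 + c, over any commutative ring so that integer,
  rational and complex orbits can be compared.\<close>

definition unicrit :: "'a::comm_ring_1 \<Rightarrow> nat \<Rightarrow> 'a" where
  "unicrit c n = ((\<lambda>z. z^2 + c) ^^ n) 0"

lemma unicrit_0 [simp]: "unicrit c 0 = 0"
  and unicrit_Suc [simp]: "unicrit c (Suc n) = (unicrit c n)^2 + c"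
  by (simp_all add: unicrit_def)

lemma unicrit_of_rat: "unicrit (of_rat r :: complex) n = of_rat (unicrit r n)"
  by (induction n) (simp_all add: of_rat_add of_rat_power)

lemma unicrit_of_int: "unicrit (of_int k :: rat) n = of_int (unicrit k n)"
  by (induction n) simp_all

text \<open>Squaring squares the denominator, and adding \<open>r\<close> changes the new numerator
  only by a multiple of \<open>q\<close>, so nothing cancels.\<close>

lemma unicrit_denominator:
  assumes "r = of_int p / of_int q" "q > 0" "coprime p q"
  shows "\<exists>a. unicrit (r::rat) (Suc n) = of_int a / of_int q ^ (2 ^ n) \<and> coprime a q"
proof (induction n)
  case 0
  show ?case using assms by auto
next
  case (Suc n)
  then obtain a where a: "unicrit r (Suc n) = of_int a / of_int q ^ (2 ^ n)" "coprime a q" by blast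
  \<comment> \<open>\<open>Suc k\<close> is the power of \<open>q\<close> multiplying
    \<open>p\<close> over the common denominator; its being positive keeps the numerator coprime to
    \<open>q\<close>.\<close>
  obtain k where k: "(2::nat) ^ n + 2 ^ n = Suc (Suc k)"
    by (metis add_Suc_right not0_implies_Suc power_not_zero add_Suc zero_neq_numeral)
  have "unicrit r (Suc (Suc n)) = of_int (a^2 + p * q ^ Suc k) / of_int q ^ (2 ^ Suc n)"
  proof -
    have "unicrit r (Suc (Suc n)) = (of_int a / of_int q ^ (2 ^ n))^2 + of_int p / of_int q"
      using a(1) assms(1) by simp
    also have "(of_int a / of_int q ^ (2 ^ n) :: rat)^2 = of_int (a^2) / of_int q ^ (Suc (Suc k))"
      by (simp add: power_divide power_mult[symmetric] mult_2_right flip: k power_add)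
    also have "of_int (a^2) / of_int q ^ (Suc (Suc k)) + of_int p / of_int q =
        (of_int (a^2 + p * q ^ Suc k) / of_int q ^ Suc (Suc k) :: rat)"
      using assms(2) by (simp add: field_simps)
    also have "Suc (Suc k) = 2 ^ Suc n" using k by simp
    finally show ?thesis .
  qed
  moreover have "coprime (a^2 + p * q ^ Suc k) q"
  proof -
    have "coprime (a^2) q" using a(2) by simp
    then have "gcd (a^2 + (p * q ^ k) * q) q = 1"
      by (metis coprime_iff_gcd_eq_1 gcd.commute gcd_add_mult add.commute)
    then show ?thesis by (simp add: coprime_iff_gcd_eq_1 mult_ac)
  qed
  ultimately show ?case by blast
qed

lemma finite_unicrit_imp_int:
  assumes "finite (range (unicrit (r::rat)))"
  shows "r \<in> \<int>"
proof -
  obtain p q where pq: "quotient_of r = (p, q)" by fastforce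
  have r: "r = of_int p / of_int q" "q > 0" "coprime p q"
    using quotient_of_div[OF pq] quotient_of_denom_pos[OF pq] quotient_of_coprime[OF pq] by auto
  have "q = 1"
  proof (rule ccontr)
    assume "q \<noteq> 1"
    have "unicrit r (Suc m) \<noteq> unicrit r (Suc n)" if "m < n" for m n
    proof
      assume eq: "unicrit r (Suc m) = unicrit r (Suc n)"
      obtain a where a: "unicrit r (Suc m) = of_int a / of_int q ^ (2 ^ m)"
        using unicrit_denominator[OF r] by blast
      obtain b where b: "unicrit r (Suc n) = of_int b / of_int q ^ (2 ^ n)" "coprime b q"
        using unicrit_denominator[OF r] by blast
      have lt: "(2::nat) ^ m < 2 ^ n" using that by simp
      then obtain k where k: "(2::nat) ^ n = 2 ^ m + Suc k"
        using less_iff_Suc_add by (metis add_Suc_right)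
      have "(of_int b :: rat) = of_int (a * q ^ Suc k)"
        using eq r(2) unfolding a b(1) k by (simp add: field_simps power_add)
      then have "b = a * q ^ Suc k" by (simp only: of_int_eq_iff)
      then have "q dvd b" by simp
      with b(2) have "is_unit q" by (meson coprime_common_divisor dvd_refl)
      with r(2) \<open>q \<noteq> 1\<close> show False by simp
    qed
    then have "inj (\<lambda>n. unicrit r (Suc n))"
      by (metis (mono_tags, lifting) injI linorder_neqE_nat)
    moreover have "finite (range (\<lambda>n. unicrit r (Suc n)))"
      by (rule finite_subset[OF _ assms]) blast
    ultimately show False
      using finite_imageD infinite_UNIV_nat by blast
  qed
  with r show ?thesis by simp
qed

text \<open>For \<open>k \<ge> 1\<close> every integer is increased; for \<open>k \<le> -3\<close>
  absolute values increase from \<open>k\<close> onwards. Either contradicts a maximum over a finite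
  orbit.\<close>

lemma finite_unicrit_int:
  assumes fin: "finite (range (unicrit (k::int)))"
  shows "k \<in> {0, -1, -2}"
proof (rule ccontr)
  assume "k \<notin> {0, -1, -2}"
  then consider "k \<ge> 1" | "k \<le> -3" by fastforce
  then show False
  proof cases
    case 1
    obtain n where n: "Max (range (unicrit k)) = unicrit k n"
      using Max_in[OF fin] by auto
    have "unicrit k (Suc n) \<le> unicrit k n"
      using Max_ge[OF fin, of "unicrit k (Suc n)"] n by (metis rangeI)
    moreover have "x < x^2 + k" for x :: int
      using 1 zero_le_power2[of "2 * x - 1"] by (simp add: power2_eq_square algebra_simps)
    ultimately show False by (simp add: not_le[symmetric])
  next
    case 2
    let ?V = "range (\<lambda>n. \<bar>unicrit k (Suc n)\<bar>)"
    have grow: "\<bar>x\<bar> < \<bar>x^2 + k\<bar>" if "\<bar>x\<bar> \<ge> -k" for x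
    proof -
      have "\<bar>x\<bar> * 3 \<le> \<bar>x\<bar> * \<bar>x\<bar>" using that 2 by (intro mult_left_mono) auto
      moreover have "\<bar>x\<bar> * \<bar>x\<bar> = x^2" by (simp add: power2_eq_square)
      ultimately have "3 * \<bar>x\<bar> \<le> x^2" by simp
      with that 2 show ?thesis by linarith
    qed
    have big: "\<bar>unicrit k (Suc n)\<bar> \<ge> -k" for n
    proof (induction n)
      case (Suc n)
      from grow[OF this] show ?case using Suc by simp
    qed simp
    have finV: "finite ?V"
      by (rule finite_subset[OF _ finite_imageI[OF fin, of abs]]) blast
    obtain n where n: "Max ?V = \<bar>unicrit k (Suc n)\<bar>"
      using Max_in[OF finV] by auto
    have "\<bar>unicrit k (Suc (Suc n))\<bar> \<le> \<bar>unicrit k (Suc n)\<bar>"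
      unfolding n[symmetric] by (intro Max_ge[OF finV] rangeI)
    with grow[OF big[of n]] show False by simp
  qed
qed

lemma finite_unicrit_rat:
  assumes "finite (range (unicrit (of_rat r :: complex)))"
  shows "r \<in> {0, -1, -2}"
proof -
  have "range (unicrit (of_rat r :: complex)) = of_rat ` range (unicrit r)"
    by (auto simp: unicrit_of_rat image_image)
  with assms have fin: "finite (range (unicrit r))"
    using finite_imageD[of "of_rat :: rat \<Rightarrow> complex"] by (simp add: inj_on_def)
  then obtain k where k: "r = of_int k"
    using finite_unicrit_imp_int by (auto elim: Ints_cases)
  have "range (unicrit r) = of_int ` range (unicrit k)"
    by (auto simp: k unicrit_of_int image_image)
  with fin have "finite (range (unicrit k))"
    using finite_imageD[of "of_int :: int \<Rightarrow> rat"] by (simp add: inj_on_def)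
  from finite_unicrit_int[OF this] show ?thesis by (auto simp: k)
qed

section \<open>Orbits of the critical curve\<close>

text \<open>The branch of 4 X Y = b c is parametrised by X = t, and \<open>P\<close> defines a curve
  containing all of its images.\<close>

locale vanishing_orbit =
  fixes b c \<alpha> \<beta> :: complex and P :: "complex poly poly" and X Y :: "nat \<Rightarrow> complex \<Rightarrow> complex"
  assumes P: "P \<noteq> 0"
    and X0: "X 0 t = t" and Y0: "Y 0 t = (b * c / 4) / t"
    and XS: "X (Suc n) t = (X n t)^2 + b * Y n t + \<alpha>"
    and YS: "Y (Suc n) t = (Y n t)^2 + c * X n t + \<beta>"
    and zero: "t \<noteq> 0 \<Longrightarrow> ev2 P (X n t) (Y n t) = 0"
begin

lemma growth_Y0: "growth (Y 0) 0 0"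
  using growth_inverse[of "b * c / 4"] by (rule growth_cong) (simp add: Y0)

lemma X0_mult_Y0: "t \<noteq> 0 \<Longrightarrow> t * Y 0 t = b * c / 4"
  by (simp add: Y0)

lemma growth_X0: "growth (X 0) 1 1"
  using growth_ident by (rule growth_cong) (simp add: X0)

lemma growth_Y1: "growth (Y 1) 1 c"
proof (rule growth_eqI)
  show "growth (\<lambda>t. Y 0 t ^ 2 + c * X 0 t + \<beta>) 1 (0 + c * 1 + 0)"
    by (intro growth_add growth_scale growth_X0 growth_lift[OF growth_const] growth_lift[OF growth_power[OF growth_Y0]])
       simp_all
qed (simp_all add: YS)

text \<open>\<open>Y (Suc n) t ^ 2\<close> and \<open>c * X (Suc n) t\<close> have the same order,
  which gives the recursion of \<open>unicrit\<close>. The crude bound on \<open>Y n\<close> makes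
  \<open>b * Y n t\<close> negligible in \<open>X (Suc n)\<close>.\<close>

lemma growth_X_Y:
  "growth (X n) (2 ^ n) 1 \<and> growth (Y n) (2 ^ n) 0 \<and> growth (Y (Suc n)) (2 ^ n) (unicrit c (Suc n))"
proof (induction n)
  case 0
  show ?case using growth_X0 growth_Y1 growth_lift[OF growth_Y0, of 1] by simp
next
  case (Suc n)
  let ?K = "2 ^ Suc n :: nat"
  have K: "2 * 2 ^ n = ?K" "2 ^ n < ?K" "0 < ?K" by simp_all
  from Suc have X: "growth (X n) (2 ^ n) 1" and Y: "growth (Y n) (2 ^ n) 0"
    and Y': "growth (Y (Suc n)) (2 ^ n) (unicrit c (Suc n))" by blast+
  have X': "growth (X (Suc n)) ?K 1"
    using growth_add[OF growth_add[OF growth_power[OF X, of 2, unfolded K]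
        growth_scale[OF growth_lift[OF Y K(2)], of b]] growth_lift[OF growth_const[of \<alpha>] K(3)]]
    by (rule growth_eqI) (simp_all add: XS)
  moreover have "growth (Y (Suc n)) ?K 0" by (rule growth_lift[OF Y' K(2)])
  moreover have "growth (Y (Suc (Suc n))) ?K (unicrit c (Suc (Suc n)))"
    using growth_add[OF growth_add[OF growth_power[OF Y', of 2, unfolded K]
        growth_scale[OF X', of c]] growth_lift[OF growth_const[of \<beta>] K(3)]]
    by (rule growth_eqI) (simp_all add: YS[of "Suc n"])
  ultimately show ?case by blast
qed

lemmas growth_X = growth_X_Y[THEN conjunct1]
  and growth_Y_Suc = growth_X_Y[THEN conjunct2, THEN conjunct2]

end

lemma finite_no_increase:
  assumes "finite (R::real set)" "G \<subseteq> R" "\<And>r. r \<in> G \<Longrightarrow> \<exists>r'\<in>G. r < r'"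
  shows "G = {}"
proof (rule ccontr)
  assume "G \<noteq> {}"
  moreover have "finite G" using assms finite_subset by blast
  ultimately show False
    using assms(3) Max_in[of G] Max_ge[of G] by (meson not_le)
qed

lemma poly_poly_const:
  fixes P :: "'a::comm_ring_1 poly poly"
  shows "poly (poly P r) y = poly (poly P [:poly r y:]) y"
  by (induction P) simp_all

context vanishing_orbit
begin

text \<open>All pairs \<open>X (Suc n)\<close>, \<open>Y (Suc n)\<close> have weights in ratio 2 :
  1, so a single \<open>q\<close> has all the leading coefficients as roots.\<close>

lemma finite_unicrit: "finite (range (unicrit c))"
proof -
  obtain q where q: "q \<noteq> 0" "\<And>u v K l. K > 0 \<Longrightarrow> growth u (2 * K) 1 \<Longrightarrow> growth v (1 * K) l \<Longrightarrow>
      (\<forall>t. t \<noteq> 0 \<longrightarrow> ev2 P (u t) (v t) = 0) \<Longrightarrow> poly q l = 0"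
    using leading_coefficient_roots[OF P, of 2 1] by auto
  have "poly q (unicrit c (Suc n)) = 0" for n
    by (rule q(2)[of "2 ^ n" "X (Suc n)" "Y (Suc n)"])
       (use growth_X[of "Suc n"] growth_Y_Suc[of n] zero in simp_all)
  then have "range (unicrit c) \<subseteq> insert 0 {l. poly q l = 0}"
    by (metis (mono_tags, lifting) image_subsetI insertCI mem_Collect_eq not0_implies_Suc unicrit_0)
  then show ?thesis
    using poly_roots_finite[OF q(1)] finite_subset by blast
qed

section \<open>Relative growth for c = -1\<close>

text \<open>The square of \<open>X N t\<close> cancels, which leaves
  \<open>X N t * Y N t ^ 2\<close> as the candidate for the leading term.\<close>

lemma Y_two_steps:
  assumes "c = -1"
  shows "Y (Suc (Suc N)) t = -2 * (X N t * Y N t ^ 2) + (Y N t ^ 4 + (2 * \<beta> * Y N t ^ 2 +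
    (-2 * \<beta> * X N t + (- b * Y N t + (\<beta>^2 + \<beta> - \<alpha>)))))"
  unfolding XS YS assms by algebra

text \<open>\<open>2 * k < 2 ^ N\<close> makes \<open>Y N t ^ 4\<close> smaller than the leading
  term; the last hypothesis does the same for \<open>-2 * \<beta> * X N t\<close>.\<close>

lemma growth_Y_two_steps:
  assumes c: "c = -1" and Y: "growth (Y N) k l" "2 * k < 2 ^ N" "k > 0 \<or> \<beta> = 0"
  shows "growth (Y (Suc (Suc N))) (2 ^ N + 2 * k) (-2 * l^2)"
proof -
  let ?K = "2 ^ N + 2 * k"
  have "growth (\<lambda>t. -2 * \<beta> * X N t) ?K 0"
  proof (cases "\<beta> = 0")
    case True
    then show ?thesis by (simp add: growth_zero)
  next
    case False
    with Y(3) have "2 ^ N < ?K" by simp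
    from growth_scale[OF growth_lift[OF growth_X this], of "-2 * \<beta>"] show ?thesis by simp
  qed
  moreover have "growth (\<lambda>t. Y N t ^ 4) ?K 0"
    by (rule growth_lift[OF growth_power[OF Y(1)]]) (use Y(2) in simp)
  moreover have "growth (\<lambda>t. 2 * \<beta> * Y N t ^ 2) ?K (2 * \<beta> * 0)"
    by (intro growth_scale growth_lift[OF growth_power[OF Y(1)]]) simp
  moreover have "growth (\<lambda>t. - b * Y N t) ?K (- b * 0)"
    by (rule growth_scale, rule growth_lift[OF Y(1)]) (use Y(2) in linarith)
  moreover have "growth (\<lambda>t. \<beta>^2 + \<beta> - \<alpha>) ?K 0"
    by (rule growth_lift[OF growth_const]) simp
  moreover have "growth (\<lambda>t. -2 * (X N t * Y N t ^ 2)) ?K (-2 * (1 * l ^ 2))"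
    by (intro growth_scale growth_mult growth_X growth_power Y)
  ultimately have "growth (\<lambda>t. -2 * (X N t * Y N t ^ 2) + (Y N t ^ 4 + (2 * \<beta> * Y N t ^ 2 +
    (-2 * \<beta> * X N t + (- b * Y N t + (\<beta>^2 + \<beta> - \<alpha>)))))) ?K
      (-2 * (1 * l ^ 2) + (0 + (2 * \<beta> * 0 + (0 + (- b * 0 + 0)))))"
    by (intro growth_add)
  then show ?thesis
    by (rule growth_eqI) (simp_all only: Y_two_steps[OF c], simp_all)
qed

text \<open>With \<open>c = -1\<close> the leading terms of \<open>Y\<close> cancel in every other step, and the growth exponent
  \<open>r < 1/2\<close> of \<open>Y\<close> relative to \<open>X\<close> becomes \<open>(1 + 2 r) / 4 > r\<close>.\<close>

lemma growth_Y_c_m1_False: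
  assumes c: "c = -1" and Y: "growth (Y N) k l" "l \<noteq> 0" "2 * k < 2 ^ N" "k > 0 \<or> \<beta> = 0"
  shows False
proof -
  \<comment> \<open>The conditions are those of \<open>growth_Y_two_steps\<close>; they hold again
    after two steps, where the new exponent is positive.\<close>
  define G where "G = {r. \<exists>N k l. growth (Y N) k l \<and> l \<noteq> 0 \<and> 2 * k < 2 ^ N \<and> (k > 0 \<or> \<beta> = 0) \<and>
    r = real k / 2 ^ N}"
  obtain R where R: "finite R" "\<And>u v A B m l. growth u A m \<Longrightarrow> growth v B l \<Longrightarrow> m \<noteq> 0 \<Longrightarrow> l \<noteq> 0 \<Longrightarrow>
    \<forall>t. t \<noteq> 0 \<longrightarrow> ev2 P (u t) (v t) = 0 \<Longrightarrow> A > 0 \<Longrightarrow> real B / real A \<in> R"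
    using finite_exponent_ratios[OF P] by (elim exE conjE) metis
  have "G = {}"
  proof (rule finite_no_increase[OF R(1)])
    show "G \<subseteq> R"
    proof
      fix r assume "r \<in> G"
      then obtain N k l where N: "growth (Y N) k l" "l \<noteq> 0" "r = real k / 2 ^ N"
        by (auto simp: G_def)
      from R(2)[OF growth_X N(1) _ N(2)] zero show "r \<in> R"
        by (simp add: N(3))
    qed
  next
    fix r assume "r \<in> G"
    then obtain N k l where N: "growth (Y N) k l" "l \<noteq> 0" "2 * k < 2 ^ N" "k > 0 \<or> \<beta> = 0"
        "r = real k / 2 ^ N"
      by (auto simp: G_def)
    have "growth (Y (Suc (Suc N))) (2 ^ N + 2 * k) (-2 * l^2)"
      by (rule growth_Y_two_steps[OF c N(1,3,4)])
    moreover have "2 * (2 ^ N + 2 * k) < (2::nat) ^ Suc (Suc N)" using N(3) by simp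
    ultimately have "real (2 ^ N + 2 * k) / 2 ^ Suc (Suc N) \<in> G"
      unfolding G_def using N(2) by fastforce
    moreover have "r < real (2 ^ N + 2 * k) / 2 ^ Suc (Suc N)"
    proof -
      have "real (2 * k) < real (2 ^ N)" using N(3) by (simp only: of_nat_less_iff)
      then show ?thesis by (simp add: N(5) field_simps)
    qed
    ultimately show "\<exists>r'\<in>G. r < r'" by blast
  qed
  with Y show False by (auto simp: G_def)
qed

text \<open>Each nonzero parameter would start the growth argument: first \<open>\<beta>\<close>,
  then \<open>\<alpha>\<close>, through the leading term of \<open>Y 2\<close>, and finally
  \<open>b\<close> through that of \<open>Y 4\<close>.\<close>

lemma c_m1_imp:
  assumes c: "c = -1"
  shows "\<alpha> = 0 \<and> \<beta> = 0 \<and> b = 0"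
proof -
  define s where "s = b * c / 4"
  have ts: "t * Y 0 t = s" if "t \<noteq> 0" for t using X0_mult_Y0[OF that] by (simp add: s_def)
  \<comment> \<open>On the initial branch the product of the coordinates is the constant
    \<open>s\<close>, so the former leading term decays.\<close>
  have Y2: "Y 2 t = -2 * s * Y 0 t + (Y 0 t ^ 4 + (2 * \<beta> * Y 0 t ^ 2 +
      (- b * Y 0 t + (-2 * \<beta> * t + (\<beta>^2 + \<beta> - \<alpha>)))))" if "t \<noteq> 0" for t
    using Y_two_steps[OF c, of 0 t] ts[OF that, symmetric]
    by (simp add: numeral_2_eq_2[symmetric] X0 power2_eq_square algebra_simps)
  have Y0p: "growth (\<lambda>t. Y 0 t ^ n) 0 0" if "n > 0" for n
    using growth_power[OF growth_Y0, of n] that by (simp add: power_0_left)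
  have small: "growth (\<lambda>t. -2 * s * Y 0 t + (Y 0 t ^ 4 + (2 * \<beta> * Y 0 t ^ 2 + - b * Y 0 t))) 0
     (-2 * s * 0 + (0 + (2 * \<beta> * 0 + - b * 0)))"
    by (intro growth_add growth_scale growth_Y0 Y0p) simp_all
  have \<beta>: "\<beta> = 0"
  proof (rule ccontr)
    assume "\<beta> \<noteq> 0"
    have "growth (\<lambda>t. (-2 * s * Y 0 t + (Y 0 t ^ 4 + (2 * \<beta> * Y 0 t ^ 2 + - b * Y 0 t))) +
        (-2 * \<beta> * t + (\<beta>^2 + \<beta> - \<alpha>))) 1 (0 + (-2 * \<beta> * 1 + 0))"
      by (intro growth_add growth_lift[OF small] growth_scale growth_ident growth_lift[OF growth_const])
         simp_all
    then have "growth (Y 2) 1 (-2 * \<beta>)"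
      by (rule growth_eqI) (simp_all add: Y2)
    from growth_Y_c_m1_False[OF c this] \<open>\<beta> \<noteq> 0\<close> show False by simp
  qed
  have \<alpha>: "\<alpha> = 0"
  proof (rule ccontr)
    assume "\<alpha> \<noteq> 0"
    have "growth (Y 2) 0 (-\<alpha>)"
      by (rule growth_eqI[OF growth_add[OF small growth_const[of "-\<alpha>"]]]) (simp_all add: Y2 \<beta>)
    from growth_Y_c_m1_False[OF c this] \<open>\<alpha> \<noteq> 0\<close> \<beta> show False by simp
  qed
  have "b = 0"
  proof (rule ccontr)
    assume b: "b \<noteq> 0"
    \<comment> \<open>The coefficient of 1/t in \<open>Y 2\<close>, namely
      \<open>-2 * s^2 - b * s\<close> with \<open>s = - b / 4\<close>.\<close>
    define L where "L = b^2 / 8"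
    have tY2: "growth (\<lambda>t. t * Y 2 t) 0 L"
    proof (rule growth_eqI)
      show "growth (\<lambda>t. (-2 * s^2 - b * s) + s * Y 0 t ^ 3) 0 ((-2 * s^2 - b * s) + s * 0)"
        by (intro growth_add growth_scale growth_const Y0p) simp
      show "t * Y 2 t = (-2 * s^2 - b * s) + s * Y 0 t ^ 3" if "t \<noteq> 0" for t
        using Y2[OF that] \<alpha> \<beta> ts[OF that] by simp algebra
    qed (simp_all add: L_def s_def c power2_eq_square field_simps)
    \<comment> \<open>Reading the constant 1 with exponent 1 and coefficient 0 lets
      \<open>growth_mult_decay\<close> show that \<open>Y 2\<close> tends to 0.\<close>
    have "growth (\<lambda>t. (1::complex)) (Suc 0) 0" by (rule growth_lift[OF growth_const]) simp
    from growth_mult_decay[OF this tY2] have Y2_0: "growth (Y 2) 0 0" by simp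
    have "growth (X 2) (Suc 3) 1" using growth_X[of 2] by simp
    from growth_mult_decay[OF this tY2] have "growth (\<lambda>t. X 2 t * Y 2 t) (Suc 2) (1 * L)"
      by (simp add: numeral_3_eq_3 numeral_2_eq_2)
    from growth_mult_decay[OF this tY2] have XY: "growth (\<lambda>t. X 2 t * Y 2 t * Y 2 t) 2 (1 * L * L)"
      by simp
    have "growth (\<lambda>t. -2 * (X 2 t * Y 2 t * Y 2 t) + (Y 2 t ^ 4 + - b * Y 2 t)) 2
        (-2 * (1 * L * L) + (0 + - b * 0))"
      by (intro growth_add growth_scale XY growth_lift[OF growth_power[OF Y2_0]] growth_lift[OF Y2_0])
         simp_all
    then have "growth (Y 4) 2 (-2 * L^2)"
    proof (rule growth_eqI)
      show "Y 4 t = -2 * (X 2 t * Y 2 t * Y 2 t) + (Y 2 t ^ 4 + - b * Y 2 t)" for t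
        using Y_two_steps[OF c, of 2 t] by (simp add: \<alpha> \<beta> numeral_eq_Suc power2_eq_square)
    qed (simp_all add: power2_eq_square)
    from growth_Y_c_m1_False[OF c this] b show False by (simp add: L_def)
  qed
  with \<alpha> \<beta> show ?thesis by blast
qed


section \<open>Relative growth for c = -2\<close>

text \<open>The summand \<open>\<beta>\<close> is chosen so that
  \<open>Y (Suc n) t = E n t + 2 * X n t\<close> when \<open>c = -2\<close>.\<close>

definition E :: "nat \<Rightarrow> complex \<Rightarrow> complex" where
  "E n t = Y n t ^ 2 - 4 * X n t + \<beta>"

text \<open>The main part is (E + 2 X)^2 - 4 X^2 = 4 X E + E^2.\<close>

lemma E_step:
  assumes "c = -2"
  shows "E (Suc N) t = 4 * (X N t * E N t) + (E N t ^ 2 + (-4 * b * Y N t + (\<beta> - 4 * \<alpha>)))"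
  unfolding E_def XS YS assms by algebra

lemma unicrit_m2: "unicrit (-2 :: complex) (Suc n) = -2 \<or> unicrit (-2 :: complex) (Suc n) = 2"
  by (induction n) auto

lemma growth_E_step:
  assumes c: "c = -2" and E: "growth (E (Suc N)) k l" "k < 2 ^ Suc N"
  shows "growth (E (Suc (Suc N))) (2 ^ Suc N + k) (4 * l)"
proof -
  let ?K = "2 ^ Suc N + k"
  have "growth (\<lambda>t. 4 * (X (Suc N) t * E (Suc N) t) + (E (Suc N) t ^ 2 +
      (-4 * b * Y (Suc N) t + (\<beta> - 4 * \<alpha>)))) ?K (4 * (1 * l) + (0 + (-4 * b * 0 + 0)))"
  proof (intro growth_add growth_scale growth_mult growth_X E growth_lift[OF growth_const])
    show "growth (\<lambda>t. E (Suc N) t ^ 2) ?K 0"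
      by (rule growth_lift[OF growth_power[OF E(1)]]) (use E(2) in simp)
    show "growth (\<lambda>t. Y (Suc N) t) ?K 0"
      by (rule growth_lift[OF growth_Y_Suc]) (simp add: trans_less_add1)
  qed simp
  then show ?thesis
    by (rule growth_eqI) (simp_all only: E_step[OF c], simp_all)
qed

text \<open>With \<open>c = -2\<close> the image curves approach the invariant curve \<open>y\<^sup>2 = 4 x\<close> of the case
  \<open>\<alpha> = \<beta> = b = 0\<close>. If \<open>r < 2\<close> is the growth exponent of \<open>E\<close> relative to \<open>Y\<close>, then the next
  one is \<open>1 + r / 2 > r\<close>.\<close>

lemma growth_E_c_m2_False:
  assumes c: "c = -2" and E: "growth (E (Suc N)) k l" "l \<noteq> 0" "k < 2 ^ Suc N"
  shows False
proof -
  define G where "G = {r. \<exists>N k l. growth (E (Suc N)) k l \<and> l \<noteq> 0 \<and> k < 2 ^ Suc N \<and>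
    r = real k / 2 ^ N}"
  \<comment> \<open>\<open>P\<close> rewritten in the coordinates (E, Y), by substituting X = (Y^2 +
    \<beta> - E) / 4.\<close>
  define Q where "Q = pcompose P [:[:\<beta> / 4, 0, 1 / 4:], [:- 1 / 4:]:]"
  have "Q \<noteq> 0"
    unfolding Q_def using P by (subst pcompose_eq_0_iff) auto
  obtain R where R: "finite R" "\<And>u v A B m l. growth u A m \<Longrightarrow> growth v B l \<Longrightarrow> m \<noteq> 0 \<Longrightarrow> l \<noteq> 0 \<Longrightarrow>
    \<forall>t. t \<noteq> 0 \<longrightarrow> ev2 Q (u t) (v t) = 0 \<Longrightarrow> B > 0 \<Longrightarrow> real A / real B \<in> R"
    using finite_exponent_ratios[OF \<open>Q \<noteq> 0\<close>] by (elim exE conjE) metis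
  have evQ: "ev2 Q e y = ev2 P ((y^2 + \<beta> - e) / 4) y" for e y
  proof -
    have "poly (poly [:[:\<beta> / 4, 0, 1 / 4:], [:- 1 / 4:]:] [:e:]) y = (y^2 + \<beta> - e) / 4"
      by (simp add: power2_eq_square add_divide_distrib diff_divide_distrib)
    then show ?thesis
      unfolding ev2_def Q_def poly_pcompose by (subst poly_poly_const) (simp only:)
  qed
  have "(Y n t ^ 2 + \<beta> - E n t) / 4 = X n t" for n t
    by (simp add: E_def)
  then have zeroQ: "ev2 Q (E n t) (Y n t) = 0" if "t \<noteq> 0" for n t
    using zero[OF that] by (simp add: evQ)
  have "G = {}"
  proof (rule finite_no_increase[OF R(1)])
    show "G \<subseteq> R"
    proof
      fix r assume "r \<in> G"
      then obtain N k l where N: "growth (E (Suc N)) k l" "l \<noteq> 0" "r = real k / 2 ^ N"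
        by (auto simp: G_def)
      have "unicrit c (Suc N) \<noteq> 0" using unicrit_m2[of N] c by auto
      from R(2)[OF N(1) growth_Y_Suc N(2) this] zeroQ show "r \<in> R"
        by (simp add: N(3))
    qed
  next
    fix r assume "r \<in> G"
    then obtain N k l where N: "growth (E (Suc N)) k l" "l \<noteq> 0" "k < 2 ^ Suc N" "r = real k / 2 ^ N"
      by (auto simp: G_def)
    have "growth (E (Suc (Suc N))) (2 ^ Suc N + k) (4 * l)"
      by (rule growth_E_step[OF c N(1,3)])
    moreover have "2 ^ Suc N + k < (2::nat) ^ Suc (Suc N)" using N(3) by simp
    ultimately have "real (2 ^ Suc N + k) / 2 ^ Suc N \<in> G"
      unfolding G_def using N(2) by fastforce
    moreover have "r < real (2 ^ Suc N + k) / 2 ^ Suc N"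
    proof -
      have "real k < real (2 ^ Suc N)" using N(3) by (simp only: of_nat_less_iff)
      then show ?thesis by (simp add: N(4) field_simps)
    qed
    ultimately show "\<exists>r'\<in>G. r < r'" by blast
  qed
  with E show False by (auto simp: G_def)
qed

text \<open>Nonzero \<open>\<beta>\<close>, then nonzero \<open>\<alpha>\<close>, shows in the
  leading term of \<open>E 1\<close>. Once both vanish, \<open>E 1\<close> behaves like b^2 / t and
  \<open>E 2\<close> has coefficient \<open>4 * b * (b + 2)\<close> at t, whence the exceptional
  value -2.\<close>

lemma c_m2_imp:
  assumes c: "c = -2"
  shows "\<alpha> = 0 \<and> \<beta> = 0 \<and> b \<in> {0, -2}"
proof -
  define s where "s = b * c / 4"
  have ts: "t * Y 0 t = s" if "t \<noteq> 0" for t using X0_mult_Y0[OF that] by (simp add: s_def)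
  have E1: "E 1 t = Y 0 t ^ 4 + (2 * \<beta> * Y 0 t ^ 2 + (-4 * s - 4 * b) * Y 0 t) +
      (-4 * \<beta> * t + (\<beta>^2 + \<beta> - 4 * \<alpha>))" if "t \<noteq> 0" for t
  proof -
    have "E 1 t = Y 0 t ^ 4 - 4 * (t * Y 0 t * Y 0 t) + 2 * \<beta> * Y 0 t ^ 2 - 4 * b * Y 0 t
        - 4 * \<beta> * t + (\<beta>^2 + \<beta> - 4 * \<alpha>)"
      unfolding E_def One_nat_def XS YS X0 c by algebra
    then show ?thesis unfolding ts[OF that] by (simp add: algebra_simps)
  qed
  have Y0p: "growth (\<lambda>t. Y 0 t ^ n) 0 0" if "n > 0" for n
    using growth_power[OF growth_Y0, of n] that by (simp add: power_0_left)
  have small: "growth (\<lambda>t. Y 0 t ^ 4 + (2 * \<beta> * Y 0 t ^ 2 + (-4 * s - 4 * b) * Y 0 t)) 0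
     (0 + (2 * \<beta> * 0 + (-4 * s - 4 * b) * 0))"
    by (intro growth_add growth_scale growth_Y0 Y0p) simp_all
  have \<beta>: "\<beta> = 0"
  proof (rule ccontr)
    assume "\<beta> \<noteq> 0"
    have "growth (\<lambda>t. (Y 0 t ^ 4 + (2 * \<beta> * Y 0 t ^ 2 + (-4 * s - 4 * b) * Y 0 t)) +
        (-4 * \<beta> * t + (\<beta>^2 + \<beta> - 4 * \<alpha>))) 1 (0 + (-4 * \<beta> * 1 + 0))"
      by (intro growth_add growth_lift[OF small] growth_scale growth_ident growth_lift[OF growth_const])
         simp_all
    then have "growth (E (Suc 0)) 1 (-4 * \<beta>)"
      by (rule growth_eqI) (simp_all add: E1[simplified])
    from growth_E_c_m2_False[OF c this] \<open>\<beta> \<noteq> 0\<close> show False by simp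
  qed
  have \<alpha>: "\<alpha> = 0"
  proof (rule ccontr)
    assume "\<alpha> \<noteq> 0"
    have "growth (E (Suc 0)) 0 (-4 * \<alpha>)"
    proof (rule growth_eqI[OF growth_add[OF small growth_const[of "-4 * \<alpha>"]]])
      show "E (Suc 0) t = Y 0 t ^ 4 + (2 * \<beta> * Y 0 t ^ 2 + (-4 * s - 4 * b) * Y 0 t) + - 4 * \<alpha>"
        if "t \<noteq> 0" for t
        unfolding E1[OF that, unfolded One_nat_def] by (simp add: \<beta>)
    qed simp_all
    from growth_E_c_m2_False[OF c this] \<open>\<alpha> \<noteq> 0\<close> show False by simp
  qed
  have "b \<in> {0, -2}"
  proof (rule ccontr)
    assume b: "b \<notin> {0, -2}"
    have tE: "growth (\<lambda>t. t * E 1 t) 0 (b^2)"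
    proof (rule growth_eqI)
      show "growth (\<lambda>t. (-4 * s - 4 * b) * s + s * Y 0 t ^ 3) 0 ((-4 * s - 4 * b) * s + s * 0)"
        by (intro growth_add growth_scale growth_const Y0p) simp
      show "t * E 1 t = (-4 * s - 4 * b) * s + s * Y 0 t ^ 3" if "t \<noteq> 0" for t
      proof -
        have "t * E 1 t = (-4 * s - 4 * b) * (t * Y 0 t) + (t * Y 0 t) * Y 0 t ^ 3"
          unfolding E1[OF that] by (simp add: \<alpha> \<beta> algebra_simps power4_eq_xxxx power3_eq_cube)
        then show ?thesis unfolding ts[OF that] .
      qed
    qed (simp_all add: s_def c power2_eq_square field_simps)
    have "growth (\<lambda>t. (1::complex)) (Suc 0) 0" by (rule growth_lift[OF growth_const]) simp
    from growth_mult_decay[OF this tE] have E1_0: "growth (E 1) 0 0" by simp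
    have "growth (X 1) (Suc 1) 1" using growth_X[of 1] by (simp add: numeral_2_eq_2)
    from growth_mult_decay[OF this tE] have XE: "growth (\<lambda>t. X 1 t * E 1 t) 1 (1 * b^2)"
      by simp
    have "growth (\<lambda>t. 4 * (X 1 t * E 1 t) + (E 1 t ^ 2 + -4 * b * Y 1 t)) 1
        (4 * (1 * b^2) + (0 + -4 * b * c))"
      by (intro growth_add growth_scale XE growth_Y1 growth_lift[OF growth_power[OF E1_0]]) simp
    then have "growth (E (Suc 1)) 1 (4 * b * (b + 2))"
    proof (rule growth_eqI)
      show "E (Suc 1) t = 4 * (X 1 t * E 1 t) + (E 1 t ^ 2 + -4 * b * Y 1 t)" for t
        unfolding E_step[OF c] by (simp add: \<alpha> \<beta>)
    qed (simp_all add: c power2_eq_square algebra_simps)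
    moreover have "4 * b * (b + 2) \<noteq> 0" using b eq_neg_iff_add_eq_0[of b 2] by simp
    ultimately show False by (rule growth_E_c_m2_False[OF c]) simp
  qed
  with \<alpha> \<beta> show ?thesis by blast
qed

text \<open>The branch is the line Y = 0, so each \<open>Y n\<close> is constant in t and the
  weights are 1 and 0.\<close>

lemma product_finite_unicrit:
  assumes c: "c = 0" and b: "b = 0"
  shows "finite (range (unicrit \<beta>))"
proof -
  obtain q where q: "q \<noteq> 0" "\<And>u v K l. K > 0 \<Longrightarrow> growth u (1 * K) 1 \<Longrightarrow> growth v (0 * K) l \<Longrightarrow>
      (\<forall>t. t \<noteq> 0 \<longrightarrow> ev2 P (u t) (v t) = 0) \<Longrightarrow> poly q l = 0"
    using leading_coefficient_roots[OF P, of 1 0] by auto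
  have Y: "Y n t = unicrit \<beta> n" for n t
    by (induction n) (simp_all add: Y0 YS b c)
  have "growth (Y n) 0 (unicrit \<beta> n)" for n
    by (rule growth_eqI[OF growth_const]) (simp_all add: Y)
  then have "poly q (unicrit \<beta> n) = 0" for n
    by (intro q(2)[of "2 ^ n" "X n" "Y n"]) (use growth_X[of n] zero in simp_all)
  then have "range (unicrit \<beta>) \<subseteq> {l. poly q l = 0}" by blast
  then show ?thesis
    using poly_roots_finite[OF q(1)] finite_subset by blast
qed

end

section \<open>Classification\<close>

text \<open>For \<open>X = x + a/2\<close> and \<open>Y = y + d/2\<close>, the constants in the normal form are
  \<open>\<alpha> = offset a b d\<close> and \<open>\<beta> = offset d c a\<close>.\<close>

definition offset :: "'a::field \<Rightarrow> 'a \<Rightarrow> 'a \<Rightarrow> 'a" where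
  "offset a b d = a / 2 - a^2 / 4 - b * d / 2"

lemma offset_of_rat: "offset (of_rat a) (of_rat b) (of_rat d) = (of_rat (offset a b d) :: complex)"
  by (simp add: offset_def of_rat_diff of_rat_divide of_rat_power of_rat_mult)

lemma proj_conj_translate:
  assumes "offset a b d = offset a' b d'" "offset d c a = offset d' c a'"
  shows "proj_conj (fmap a b c d) (fmap a' b c d')"
proof -
  define s where "s = (a' - a) / 2"
  define r where "r = (d' - d) / 2"
  define M :: "complex^3^3" where
    "M = vector [vector [1, 0, s], vector [0, 1, r], vector [0, 0, 1]]"
  have Mp: "(M *v p) $ 1 = p$1 + s * p$3" "(M *v p) $ 2 = p$2 + r * p$3" "(M *v p) $ 3 = p$3" for p
    by (simp_all add: M_def matrix_vector_mult_def sum_3 vector_3)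
  have "invertible M"
    by (simp add: invertible_det_nz det_3 M_def vector_3)
  have a': "a' = 2 * s + a" and d': "d' = 2 * r + d" by (simp_all add: s_def r_def diff_divide_distrib)
  \<comment> \<open>Both affine maps fix the origin, so the translation has to carry it to a fixed
    point (s, r); this and the next equation say that it does.\<close>
  have 1: "s^2 + a * s + b * r = s"
    using assms(1) unfolding a' d' offset_def by (simp add: field_simps) algebra
  have 2: "r^2 + c * s + d * r = r"
    using assms(2) unfolding a' d' offset_def by (simp add: field_simps) algebra
  have "fmap a b c d (M *v p) = 1 *s (M *v fmap a' b c d' p)" for p
  proof -
    have "s * (p$3)^2 = (s^2 + a * s + b * r) * (p$3)^2" "r * (p$3)^2 = (r^2 + c * s + d * r) * (p$3)^2"
      by (simp_all only: 1 2)
    then show ?thesis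
      unfolding vec3_eq_iff fmap_nth vector_smult_component Mp a' d'
      by (simp add: algebra_simps power2_eq_square)
  qed
  with \<open>invertible M\<close> show ?thesis
    unfolding proj_conj_def by (metis zero_neq_one)
qed

lemma proj_conj_swap: "proj_conj (fmap a b c d) (fmap d c b a)"
proof -
  define M :: "complex^3^3" where
    "M = vector [vector [0, 1, 0], vector [1, 0, 0], vector [0, 0, 1]]"
  have Mp: "(M *v p) $ 1 = p$2" "(M *v p) $ 2 = p$1" "(M *v p) $ 3 = p$3" for p
    by (simp_all add: M_def matrix_vector_mult_def sum_3 vector_3)
  have "invertible M"
    by (simp add: invertible_det_nz det_3 M_def vector_3)
  moreover have "fmap a b c d (M *v p) = 1 *s (M *v fmap d c b a p)" for p
    unfolding vec3_eq_iff fmap_nth vector_smult_component Mp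
    by (simp add: algebra_simps)
  ultimately show ?thesis
    unfolding proj_conj_def by (metis zero_neq_one)
qed

lemma proj_conj_trans:
  assumes "proj_conj F G" "proj_conj G H"
  shows "proj_conj F H"
proof -
  obtain M where M: "invertible M" "\<And>p. p \<noteq> 0 \<Longrightarrow> \<exists>l. l \<noteq> 0 \<and> F (M *v p) = l *s (M *v G p)"
    using assms(1) by (auto simp: proj_conj_def)
  obtain N where N: "invertible N" "\<And>p. p \<noteq> 0 \<Longrightarrow> \<exists>l. l \<noteq> 0 \<and> G (N *v p) = l *s (N *v H p)"
    using assms(2) by (auto simp: proj_conj_def)
  have "\<exists>l. l \<noteq> 0 \<and> F ((M ** N) *v p) = l *s ((M ** N) *v H p)" if p: "p \<noteq> 0" for p
  proof -
    have "N *v p \<noteq> 0"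
    proof
      assume "N *v p = 0"
      moreover obtain N' where "N' ** N = mat 1" using N(1) by (auto simp: invertible_def)
      ultimately have "p = 0"
        by (metis matrix_vector_mul_assoc matrix_vector_mul_lid matrix_vector_mult_0_right)
      with p show False by simp
    qed
    with M(2) obtain l where l: "l \<noteq> 0" "F (M *v (N *v p)) = l *s (M *v G (N *v p))" by blast
    from N(2)[OF p] obtain k where k: "k \<noteq> 0" "G (N *v p) = k *s (N *v H p)" by blast
    have "F ((M ** N) *v p) = (l * k) *s ((M ** N) *v H p)"
      using l(2) by (simp add: k(2) vector_scalar_commute flip: matrix_vector_mul_assoc)
    then show ?thesis using l(1) k(1) by (intro exI[of _ "l * k"]) simp
  qed
  with M(1) N(1) show ?thesis
    unfolding proj_conj_def using invertible_mult by blast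
qed

lemma pcf_vanishing_orbit:
  assumes "pcf (fmap a b c d)"
  shows "\<exists>P X Y. vanishing_orbit b c (offset a b d) (offset d c a) P X Y"
proof -
  let ?F = "fmap a b c d" and ?\<alpha> = "offset a b d" and ?\<beta> = "offset d c a"
  obtain m cf where cf: "nonzero_hom m cf"
      "\<And>n p. p \<in> crit_locus ?F \<Longrightarrow> hom_eval m cf ((?F ^^ n) p) = 0"
    using assms by (auto simp: pcf_def)
  obtain P where P: "P \<noteq> 0" "\<And>x y. ev2 P x y = hom_eval m cf (vector [x - a / 2, y - d / 2, 1])"
    using hom_eval_shift[OF cf(1)] by metis
  \<comment> \<open>\<open>e\<close> embeds the recentred affine plane, and \<open>g\<close> is the
    normal form of the map there.\<close>
  define e :: "complex \<times> complex \<Rightarrow> complex^3" where "e z = vector [fst z - a / 2, snd z - d / 2, 1]" for z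
  define g where "g z = ((fst z)^2 + b * snd z + ?\<alpha>, (snd z)^2 + c * fst z + ?\<beta>)" for z
  have eg: "?F (e z) = e (g z)" for z
    by (simp add: vec3_eq_iff fmap_nth e_def g_def vector_3 offset_def power2_eq_square field_simps)
  define z where "z n t = (g ^^ n) (t, (b * c / 4) / t)" for n t
  have ez: "e (z n t) = (?F ^^ n) (e (z 0 t))" for n t
    by (induction n) (simp_all add: z_def flip: eg)
  have "vanishing_orbit b c ?\<alpha> ?\<beta> P (\<lambda>n t. fst (z n t)) (\<lambda>n t. snd (z n t))"
  proof
    fix t :: complex and n assume t: "t \<noteq> 0"
    have "e (z 0 t) \<in> crit_locus ?F"
      using t by (simp add: crit_locus_fmap e_def z_def vec3_eq_iff vector_3)
    from cf(2)[OF this, of n] show "ev2 P (fst (z n t)) (snd (z n t)) = 0"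
      by (simp add: P(2) flip: ez) (simp add: e_def)
  qed (simp_all add: P(1) z_def g_def)
  then show ?thesis by blast
qed

lemma rat_square_neq_5: "(x::rat)^2 \<noteq> 5"
proof
  assume x: "x^2 = 5"
  obtain p q where pq: "quotient_of x = (p, q)" by fastforce
  have r: "x = of_int p / of_int q" "q > 0" "coprime p q"
    using quotient_of_div[OF pq] quotient_of_denom_pos[OF pq] quotient_of_coprime[OF pq] by auto
  have "of_int (p^2) = (of_int (5 * q^2) :: rat)"
    using x r by (simp add: field_simps)
  then have eq: "p^2 = 5 * q^2" by (simp only: of_int_eq_iff)
  have "prime (5::int)" by simp
  then have "5 dvd p" using eq prime_dvd_power by (metis dvd_triv_left)
  then obtain k where "p = 5 * k" ..
  with eq have "q^2 = 5 * k^2" by (simp add: power2_eq_square)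
  then have "5 dvd q" using \<open>prime 5\<close> prime_dvd_power by (metis dvd_triv_left)
  with \<open>5 dvd p\<close> r(3) have "is_unit (5::int)" by (meson coprime_common_divisor)
  then show False by simp
qed

text \<open>The fixed points of z^2 - 1 are irrational, whereas x^2 + a x fixes 0; this excludes the
  value -1 over the rationals.\<close>

lemma offset_product_neq_m1: "offset (a::rat) 0 d \<noteq> -1"
proof
  assume "offset a 0 d = -1"
  then have "(a - 1)^2 = 5" by (simp add: offset_def field_simps power2_eq_square)
  with rat_square_neq_5 show False by blast
qed

lemma proj_conj_fq_same_offset:
  assumes "offset a b d = offset a' b d'" "offset d c a = offset d' c a'"
  shows "proj_conj (fq a b c d) (fq a' b c d')"
  unfolding fq_def by (rule proj_conj_translate) (simp_all only: offset_of_rat assms)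

lemma proj_conj_fq_swap: "proj_conj (fq a b c d) (fq d c b a)"
  unfolding fq_def by (rule proj_conj_swap)

text \<open>Turns every constraint on \<open>c\<close> into one on \<open>b\<close>.\<close>

lemma pcf_fq_swap: "pcf (fq a b c d) \<Longrightarrow> pcf (fq d c b a)"
  using pcf_proj_conj proj_conj_swap unfolding fq_def by blast

lemma pcf_fq_cases:
  assumes "pcf (fq a b c d)"
  shows "c \<in> {0, -1, -2}"
    and "c = -1 \<Longrightarrow> offset a b d = 0 \<and> offset d c a = 0 \<and> b = 0"
    and "c = -2 \<Longrightarrow> offset a b d = 0 \<and> offset d c a = 0 \<and> b \<in> {0, -2}"
    and "b = 0 \<Longrightarrow> c = 0 \<Longrightarrow> offset d c a \<in> {0, -2}"
proof -
  obtain P X Y where "vanishing_orbit (of_rat b) (of_rat c) (of_rat (offset a b d))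
      (of_rat (offset d c a)) P X Y"
    using pcf_vanishing_orbit[OF assms[unfolded fq_def]] by (auto simp: offset_of_rat)
  then interpret vanishing_orbit "of_rat b" "of_rat c" "of_rat (offset a b d)"
      "of_rat (offset d c a)" P X Y .
  show "c \<in> {0, -1, -2}"
    by (rule finite_unicrit_rat[OF finite_unicrit])
  have m1: "of_rat x = (-1 :: complex) \<longleftrightarrow> x = -1" and m2: "of_rat x = (-2 :: complex) \<longleftrightarrow> x = -2" for x
    using of_rat_eq_iff[of x "-1", where 'a = complex] of_rat_eq_iff[of x "-2", where 'a = complex]
    by (simp_all add: of_rat_minus)
  show "c = -1 \<Longrightarrow> offset a b d = 0 \<and> offset d c a = 0 \<and> b = 0"
    using c_m1_imp unfolding m1 of_rat_eq_0_iff by blast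
  show "c = -2 \<Longrightarrow> offset a b d = 0 \<and> offset d c a = 0 \<and> b \<in> {0, -2}"
    using c_m2_imp by (simp add: m2)
  assume "b = 0" "c = 0"
  with product_finite_unicrit have "offset d c a \<in> {0, -1, -2}"
    by (intro finite_unicrit_rat) simp
  then show "offset d c a \<in> {0, -2}"
    using offset_product_neq_m1[of d a] \<open>c = 0\<close> by auto
qed

lemma pcf_fq_conj_list:
  assumes pcf: "pcf (fq a b c d)"
  shows "\<exists>a' b' c' d'. (a', b', c', d') \<in> pcf_list \<and> proj_conj (fq a b c d) (fq a' b' c' d')"
proof -
  note cs = pcf_fq_cases[OF pcf] and cs' = pcf_fq_cases[OF pcf_fq_swap[OF pcf]]
  \<comment> \<open>Equal \<open>b\<close>, \<open>c\<close> and offsets give conjugacy by a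
    translation, so it suffices to match these. The second alternative exchanges the coordinates
    first, because asymmetric maps are listed in one order only.\<close>
  have "(\<exists>a' d'. (a', b, c, d') \<in> pcf_list \<and> offset a b d = offset a' b d' \<and> offset d c a = offset d' c a') \<or>
    (\<exists>a' d'. (d', c, b, a') \<in> pcf_list \<and> offset a b d = offset a' b d' \<and> offset d c a = offset d' c a')"
    (is "?A \<or> ?B")
  proof -
    have o: "offset 0 y (0::rat) = 0" "offset 0 (0::rat) x = 0" "offset (-2) (0::rat) x = -2" for x y
      by (simp_all add: offset_def power2_eq_square)
    consider "c = -1" | "c = -2" | "b = -1" | "b = -2" | "b = 0" "c = 0"
      using cs(1) cs'(1) by blast
    then show ?thesis
    proof cases
      case 1
      with cs(2) have "offset a b d = 0" "offset d c a = 0" "b = 0" by blast+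
      with 1 show ?thesis by (intro disjI1 exI[of _ 0]) (simp add: pcf_list_def o)
    next
      case 2
      with cs(3) have "offset a b d = 0" "offset d c a = 0" "b = 0 \<or> b = -2" by blast+
      with 2 show ?thesis by (intro disjI1 exI[of _ 0]) (auto simp: pcf_list_def o)
    next
      case 3
      with cs'(2) have "offset a b d = 0" "offset d c a = 0" "c = 0" by blast+
      with 3 show ?thesis by (intro disjI2 exI[of _ 0]) (simp add: pcf_list_def o)
    next
      case 4
      with cs'(3) have "offset a b d = 0" "offset d c a = 0" "c = 0 \<or> c = -2" by blast+
      with 4 show ?thesis by (intro disjI2 exI[of _ 0]) (auto simp: pcf_list_def o)
    next
      case 5
      have "offset d c a = 0 \<or> offset d c a = -2" "offset a b d = 0 \<or> offset a b d = -2"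
        using cs(4) cs'(4) 5 by auto
      then consider "offset d c a = 0" "offset a b d = 0" | "offset d c a = -2" "offset a b d = 0"
        | "offset d c a = 0" "offset a b d = -2" | "offset d c a = -2" "offset a b d = -2"
        by blast
      then show ?thesis
      proof cases
        case 1
        with 5 have ?A by (intro exI[of _ 0]) (simp add: o pcf_list_def)
        then show ?thesis ..
      next
        case 2
        with 5 have ?A by (intro exI[of _ 0] exI[of _ "-2"]) (simp add: o pcf_list_def)
        then show ?thesis ..
      next
        case 3
        with 5 have ?B by (intro exI[of _ "-2"] exI[of _ 0]) (simp add: o pcf_list_def)
        then show ?thesis ..
      next
        case 4
        with 5 have ?A by (intro exI[of _ "-2"]) (simp add: o pcf_list_def)
        then show ?thesis ..
      qed
    qed
  qed
  then show ?thesis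
    using proj_conj_fq_same_offset proj_conj_fq_swap proj_conj_trans by metis
qed

theorem theorem1p4:
  fixes a b c d :: rat
  shows "pcf (fq a b c d) \<longleftrightarrow>
    ((a, b, c, d) \<in> pcf_list \<or>
     (\<exists>a' b' c' d'. (a', b', c', d') \<in> pcf_list \<and> proj_conj (fq a b c d) (fq a' b' c' d')))"
  using pcf_fq_conj_list pcf_of_pcf_list pcf_proj_conj unfolding fq_def by metis

end
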